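(* Let $$G=\begin{pmatrix}0&e^{\pi i/4}\\ e^{-\pi i/4}&0\end{pmatrix},$$ and consider the channel $\mathrm{Ad}_G:\rho\mapsto G\rho G^\dagger$ on the system $(\mathbb C^2,\theta)$. Then for every $d\ge1$ and every unital channel $\mathcal E$ on the system $(\mathbb C^d,\theta)$ there exists a T-symmetric superchannel $f$ from $(\mathbb C^2,\theta)$ to $(\mathbb C^d,\theta)$ such that $f(\mathrm{Ad}_G)=\mathcal E$.
   Context: A system $A=(\mathcal H_A,\Theta_A)$ is a finite-dimensional complex Hilbert space with a fixed orthonormal computational basis, together with an antiunitary operator $\Theta_A$ (the motion-reversal operator). Here all motion-reversal operators are $\theta$, complex conjugation in the computational basis. Write $\mathrm{Ad}_O(\rho)=O\rho O^\dagger$. A channel on $A$ is a CPTP map $\mathcal B(\mathcal H_A)\to\mathcal B(\mathcal H_A)$; it is unital if it fixes $\mathbb I$. $\dagger$ on maps denotes the Hilbert–Schmidt adjoint. A deterministic superchannel $f:A\multimap B$ is a linear map from linear maps on $\mathcal B(\mathcal H_A)$ to linear maps on $\mathcal B(\mathcal H_B)$ of the form $f(\mathcal E)=\mathcal F_d\circ(\mathcal E\otimes\mathrm{id}_M)\circ\mathcal F_e$, with $M$ a finite-dimensional memory system and $\mathcal F_e:\mathcal B(\mathcal H_B)\to\mathcal B(\mathcal H_A\otimes\mathcal H_M)$, $\mathcal F_d:\mathcal B(\mathcal H_A\otimes\mathcal H_M)\to\mathcal B(\mathcal H_B)$ CPTP. Its adjoint is the supermap $f^\dagger(\mathcal E)=\mathcal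 F_e^\dagger\circ(\mathcal E\otimes\mathrm{id}_M)\circ\mathcal F_d^\dagger$ (independent of the chosen realization). Its reverse-process simulator is $$f_\Theta(\mathcal E)=\mathrm{Ad}_{\Theta_B^\dagger}\circ f^\dagger\big(\mathrm{Ad}_{\Theta_A}\circ\mathcal E\circ\mathrm{Ad}_{\Theta_A^\dagger}\big)\circ\mathrm{Ad}_{\Theta_B}.$$ A deterministic superchannel $f$ is T-symmetric if $f=f_\Theta$. *)

theory Defs
  imports "Jordan_Normal_Form.Schur_Decomposition"
begin

text \<open>
  Vectors and operators are coordinate arrays with respect to the computational basis:
  a Hilbert space of dimension \<open>n\<close> is \<open>carrier_vec n\<close>, its operator algebra is
  \<open>carrier_mat n n\<close>.  Maps between operator algebras are HOL functions of which only the
  values on the relevant carrier matter, so equality of such maps is always stated on the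
  carrier.  The inner product \<open>v \<bullet>c w\<close> is linear in \<open>v\<close> and conjugate-linear in \<open>w\<close>.
\<close>


section \<open>Operators and maps on operators\<close>

definition mat_trace :: "complex mat \<Rightarrow> complex" where
  "mat_trace X = (\<Sum>i<dim_row X. X $$ (i, i))"

definition hs_inner :: "complex mat \<Rightarrow> complex mat \<Rightarrow> complex" where
  "hs_inner X Y = mat_trace (mat_adjoint X * Y)"

definition positive_op :: "nat \<Rightarrow> complex mat \<Rightarrow> bool" where
  "positive_op n X \<longleftrightarrow> X \<in> carrier_mat n n \<and> (\<forall>v\<in>carrier_vec n. (X *\<^sub>v v) \<bullet>c v \<ge> 0)"

definition linear_map :: "nat \<Rightarrow> nat \<Rightarrow> (complex mat \<Rightarrow> complex mat) \<Rightarrow> bool" where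
  "linear_map n m F \<longleftrightarrow>
     (\<forall>X\<in>carrier_mat n n. F X \<in> carrier_mat m m) \<and>
     (\<forall>X\<in>carrier_mat n n. \<forall>Y\<in>carrier_mat n n. F (X + Y) = F X + F Y) \<and>
     (\<forall>c. \<forall>X\<in>carrier_mat n n. F (c \<cdot>\<^sub>m X) = c \<cdot>\<^sub>m F X)"

text \<open>
  In a tensor product of dimension \<open>n * k\<close> the basis vector \<open>e\<^sub>a \<otimes> e\<^sub>p\<close> has index \<open>a * k + p\<close>.
  Writing \<open>X = (\<Sum>p q. X\<^sub>p\<^sub>q \<otimes> |p\<rangle>\<langle>q|)\<close>, the operator \<open>X\<^sub>p\<^sub>q\<close> is \<open>block n k X p q\<close>.  Then
  \<open>tensor_id n m k F\<close> is \<open>F \<otimes> id\<close> with \<open>F\<close> mapping operators of size \<open>n\<close> to size \<open>m\<close>; see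
  \<open>tensor_id_kron\<close> below.
\<close>

definition block :: "nat \<Rightarrow> nat \<Rightarrow> complex mat \<Rightarrow> nat \<Rightarrow> nat \<Rightarrow> complex mat" where
  "block n k X p q = mat n n (\<lambda>(a, b). X $$ (a * k + p, b * k + q))"

definition tensor_id ::
    "nat \<Rightarrow> nat \<Rightarrow> nat \<Rightarrow> (complex mat \<Rightarrow> complex mat) \<Rightarrow> complex mat \<Rightarrow> complex mat" where
  "tensor_id n m k F X =
     mat (m * k) (m * k) (\<lambda>(i, j). F (block n k X (i mod k) (j mod k)) $$ (i div k, j div k))"

definition kron :: "complex mat \<Rightarrow> complex mat \<Rightarrow> complex mat" where
  "kron X Y = mat (dim_row X * dim_row Y) (dim_col X * dim_col Y)
     (\<lambda>(i, j). X $$ (i div dim_row Y, j div dim_col Y) * Y $$ (i mod dim_row Y, j mod dim_col Y))"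

definition completely_positive :: "nat \<Rightarrow> nat \<Rightarrow> (complex mat \<Rightarrow> complex mat) \<Rightarrow> bool" where
  "completely_positive n m F \<longleftrightarrow>
     (\<forall>k X. positive_op (n * k) X \<longrightarrow> positive_op (m * k) (tensor_id n m k F X))"

definition trace_preserving :: "nat \<Rightarrow> (complex mat \<Rightarrow> complex mat) \<Rightarrow> bool" where
  "trace_preserving n F \<longleftrightarrow> (\<forall>X\<in>carrier_mat n n. mat_trace (F X) = mat_trace X)"

definition cptp :: "nat \<Rightarrow> nat \<Rightarrow> (complex mat \<Rightarrow> complex mat) \<Rightarrow> bool" where
  "cptp n m F \<longleftrightarrow> linear_map n m F \<and> completely_positive n m F \<and> trace_preserving n F"

definition hs_adjoint ::
    "nat \<Rightarrow> nat \<Rightarrow> (complex mat \<Rightarrow> complex mat) \<Rightarrow> complex mat \<Rightarrow> complex mat" where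
  "hs_adjoint n m F Y =
     (THE Z. Z \<in> carrier_mat n n \<and> (\<forall>X\<in>carrier_mat n n. hs_inner Z X = hs_inner Y (F X)))"


section \<open>Systems and motion reversal\<close>

definition antiunitary :: "nat \<Rightarrow> (complex vec \<Rightarrow> complex vec) \<Rightarrow> bool" where
  "antiunitary n T \<longleftrightarrow>
     T ` carrier_vec n = carrier_vec n \<and>
     (\<forall>u\<in>carrier_vec n. \<forall>v\<in>carrier_vec n. T (u + v) = T u + T v) \<and>
     (\<forall>c. \<forall>v\<in>carrier_vec n. T (c \<cdot>\<^sub>v v) = cnj c \<cdot>\<^sub>v T v) \<and>
     (\<forall>u\<in>carrier_vec n. \<forall>v\<in>carrier_vec n. T u \<bullet>c T v = cnj (u \<bullet>c v))"

text \<open>The adjoint of an antilinear operator; note the complex conjugation.\<close>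

definition anti_adjoint :: "nat \<Rightarrow> (complex vec \<Rightarrow> complex vec) \<Rightarrow> complex vec \<Rightarrow> complex vec" where
  "anti_adjoint n T w =
     (THE u. u \<in> carrier_vec n \<and> (\<forall>v\<in>carrier_vec n. v \<bullet>c u = cnj (T v \<bullet>c w)))"

text \<open>
  For antilinear \<open>T\<close> the composite \<open>T \<rho> T\<^sup>\<dagger>\<close> is a linear operator; \<open>Ad_anti n T \<rho>\<close> is its matrix.
\<close>

definition Ad_anti :: "nat \<Rightarrow> (complex vec \<Rightarrow> complex vec) \<Rightarrow> complex mat \<Rightarrow> complex mat" where
  "Ad_anti n T \<rho> = mat n n (\<lambda>(i, j). T (\<rho> *\<^sub>v anti_adjoint n T (unit_vec n j)) $ i)"

definition Ad :: "complex mat \<Rightarrow> complex mat \<Rightarrow> complex mat" where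
  "Ad U \<rho> = U * \<rho> * mat_adjoint U"

record qsystem =
  hdim :: nat
  motion_rev :: "complex vec \<Rightarrow> complex vec"

definition valid_system :: "qsystem \<Rightarrow> bool" where
  "valid_system A \<longleftrightarrow> hdim A \<ge> 1 \<and> antiunitary (hdim A) (motion_rev A)"

definition conj_system :: "nat \<Rightarrow> qsystem" where
  "conj_system d = \<lparr>hdim = d, motion_rev = conjugate\<rparr>"

definition unital_channel :: "qsystem \<Rightarrow> (complex mat \<Rightarrow> complex mat) \<Rightarrow> bool" where
  "unital_channel A E \<longleftrightarrow> cptp (hdim A) (hdim A) E \<and> E (1\<^sub>m (hdim A)) = 1\<^sub>m (hdim A)"


section \<open>Superchannels\<close>

type_synonym supermap = "(complex mat \<Rightarrow> complex mat) \<Rightarrow> complex mat \<Rightarrow> complex mat"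

definition realizes ::
    "qsystem \<Rightarrow> qsystem \<Rightarrow> nat \<Rightarrow> (complex mat \<Rightarrow> complex mat) \<Rightarrow> (complex mat \<Rightarrow> complex mat)
       \<Rightarrow> supermap \<Rightarrow> bool" where
  "realizes A B k Fe Fd f \<longleftrightarrow>
     k \<ge> 1 \<and> cptp (hdim B) (hdim A * k) Fe \<and> cptp (hdim A * k) (hdim B) Fd \<and>
     (\<forall>E. linear_map (hdim A) (hdim A) E \<longrightarrow>
        (\<forall>\<rho>\<in>carrier_mat (hdim B) (hdim B).
           f E \<rho> = (Fd \<circ> tensor_id (hdim A) (hdim A) k E \<circ> Fe) \<rho>))"

definition deterministic_superchannel :: "qsystem \<Rightarrow> qsystem \<Rightarrow> supermap \<Rightarrow> bool" where
  "deterministic_superchannel A B f \<longleftrightarrow>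
     valid_system A \<and> valid_system B \<and> (\<exists>k Fe Fd. realizes A B k Fe Fd f)"

definition realized_adjoint ::
    "qsystem \<Rightarrow> qsystem \<Rightarrow> nat \<Rightarrow> (complex mat \<Rightarrow> complex mat) \<Rightarrow> (complex mat \<Rightarrow> complex mat)
       \<Rightarrow> supermap" where
  "realized_adjoint A B k Fe Fd E =
     hs_adjoint (hdim B) (hdim A * k) Fe \<circ> tensor_id (hdim A) (hdim A) k E
       \<circ> hs_adjoint (hdim A * k) (hdim B) Fd"

text \<open>
  An arbitrary realization is chosen; by \<open>superchannel_adjoint_eq\<close> below the result does not
  depend on it.
\<close>

definition superchannel_adjoint :: "qsystem \<Rightarrow> qsystem \<Rightarrow> supermap \<Rightarrow> supermap" where
  "superchannel_adjoint A B f =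
     (SOME g. \<exists>k Fe Fd. realizes A B k Fe Fd f \<and> g = realized_adjoint A B k Fe Fd)"

definition reverse_simulator :: "qsystem \<Rightarrow> qsystem \<Rightarrow> supermap \<Rightarrow> supermap" where
  "reverse_simulator A B f E =
     Ad_anti (hdim B) (anti_adjoint (hdim B) (motion_rev B))
     \<circ> superchannel_adjoint A B f
         (Ad_anti (hdim A) (motion_rev A) \<circ> E
            \<circ> Ad_anti (hdim A) (anti_adjoint (hdim A) (motion_rev A)))
     \<circ> Ad_anti (hdim B) (motion_rev B)"

definition T_symmetric :: "qsystem \<Rightarrow> qsystem \<Rightarrow> supermap \<Rightarrow> bool" where
  "T_symmetric A B f \<longleftrightarrow>
     deterministic_superchannel A B f \<and>
     (\<forall>E. linear_map (hdim A) (hdim A) E \<longrightarrow>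
        (\<forall>\<rho>\<in>carrier_mat (hdim B) (hdim B). f E \<rho> = reverse_simulator A B f E \<rho>))"

definition G_mat :: "complex mat" where
  "G_mat = mat_of_rows_list 2
     [[0, exp (of_real pi * \<i> / 4)],
      [exp (- (of_real pi * \<i> / 4)), 0]]"


section \<open>The definitions are well-behaved\<close>

lemma mat_adjoint_carrier [simp]:
  "X \<in> carrier_mat n m \<Longrightarrow> mat_adjoint (X::complex mat) \<in> carrier_mat m n"
  unfolding mat_adjoint_def by (auto simp: mat_of_rows_def)

lemma mat_adjoint_index:
  assumes "X \<in> carrier_mat n m" "i < m" "j < n"
  shows "mat_adjoint (X::complex mat) $$ (i, j) = cnj (X $$ (j, i))"
  using assms unfolding mat_adjoint_def by (auto simp: mat_of_rows_def)

lemma hs_inner_sum: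
  assumes "X \<in> carrier_mat n n" "Y \<in> carrier_mat n n"
  shows "hs_inner X Y = (\<Sum>i<n. \<Sum>j<n. cnj (X $$ (i, j)) * Y $$ (i, j))"
proof -
  have "hs_inner X Y = (\<Sum>j<n. \<Sum>i<n. cnj (X $$ (i, j)) * Y $$ (i, j))"
    using assms carrier_matD[OF mat_adjoint_carrier[OF assms(1)]]
    by (auto simp: hs_inner_def mat_trace_def scalar_prod_def mat_adjoint_index[OF assms(1)]
        atLeast0LessThan intro!: sum.cong)
  then show ?thesis by (subst sum.swap) simp
qed

lemma hs_inner_conj:
  assumes "X \<in> carrier_mat n n" "Y \<in> carrier_mat n n"
  shows "hs_inner Y X = cnj (hs_inner X Y)"
  using assms by (simp add: hs_inner_sum[of _ n] mult.commute)

definition elem_mat :: "nat \<Rightarrow> nat \<Rightarrow> nat \<Rightarrow> complex mat" where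
  "elem_mat n i j = mat n n (\<lambda>(a, b). if a = i \<and> b = j then 1 else 0)"

lemma elem_mat_carrier [simp]: "elem_mat n i j \<in> carrier_mat n n"
  by (simp add: elem_mat_def)

lemma hs_inner_elem:
  assumes "Z \<in> carrier_mat n n" "i < n" "j < n"
  shows "hs_inner Z (elem_mat n i j) = cnj (Z $$ (i, j))"
proof -
  have "hs_inner Z (elem_mat n i j) =
      (\<Sum>a<n. \<Sum>b<n. if b = j then (if a = i then cnj (Z $$ (a, b)) else 0) else 0)"
    unfolding hs_inner_sum[OF assms(1) elem_mat_carrier]
    by (intro sum.cong refl) (auto simp: elem_mat_def)
  also have "\<dots> = (\<Sum>a<n. if a = i then cnj (Z $$ (a, j)) else 0)"
    using assms by (intro sum.cong refl, subst sum.delta) auto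
  also have "\<dots> = cnj (Z $$ (i, j))" using assms by (subst sum.delta) auto
  finally show ?thesis .
qed

lemma hs_inner_eqI:
  assumes "Z \<in> carrier_mat n n" "Z' \<in> carrier_mat n n"
    and "\<And>X. X \<in> carrier_mat n n \<Longrightarrow> hs_inner Z X = hs_inner Z' X"
  shows "Z = Z'"
proof (rule eq_matI)
  fix i j assume "i < dim_row Z'" "j < dim_col Z'"
  then have "i < n" "j < n" using assms by auto
  then show "Z $$ (i, j) = Z' $$ (i, j)"
    using hs_inner_elem[OF assms(1)] hs_inner_elem[OF assms(2)] assms(3)[of "elem_mat n i j"]
    by (metis complex_cnj_cancel_iff elem_mat_carrier)
qed (use assms in auto)

lemma linear_map_carrier:
  "linear_map n m F \<Longrightarrow> X \<in> carrier_mat n n \<Longrightarrow> F X \<in> carrier_mat m m"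
  by (simp add: linear_map_def)

lemma linear_functional_rep:
  fixes L :: "complex mat \<Rightarrow> complex"
  assumes add: "\<And>X Y. X \<in> carrier_mat n n \<Longrightarrow> Y \<in> carrier_mat n n \<Longrightarrow> L (X + Y) = L X + L Y"
    and scale: "\<And>c X. X \<in> carrier_mat n n \<Longrightarrow> L (c \<cdot>\<^sub>m X) = c * L X"
    and X: "X \<in> carrier_mat n n"
  shows "L X = (\<Sum>i<n. \<Sum>j<n. X $$ (i, j) * L (elem_mat n i j))"
proof -
  have L0: "L (0\<^sub>m n n) = 0"
    using scale[of "0\<^sub>m n n" 0] by simp
  define R where "R S = mat n n (\<lambda>(a, b). if (a, b) \<in> S then X $$ (a, b) else 0)" for S
  have Rc: "R S \<in> carrier_mat n n" for S by (simp add: R_def)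
  have *: "L (R S) = (\<Sum>(i, j)\<in>S. X $$ (i, j) * L (elem_mat n i j))"
    if "finite S" "S \<subseteq> {..<n} \<times> {..<n}" for S
    using that
  proof (induction S rule: finite_induct)
    case empty
    have "R {} = 0\<^sub>m n n" by (rule eq_matI) (auto simp: R_def)
    then show ?case using L0 by simp
  next
    case (insert x S)
    obtain i j where x: "x = (i, j)" by (cases x)
    have "R (insert x S) = X $$ (i, j) \<cdot>\<^sub>m elem_mat n i j + R S"
      using insert x by (intro eq_matI) (auto simp: R_def elem_mat_def)
    then show ?case using insert x add scale Rc by simp
  qed
  have "R ({..<n} \<times> {..<n}) = X" using X by (intro eq_matI) (auto simp: R_def)
  then show ?thesis using *[of "{..<n} \<times> {..<n}"] by (simp add: sum.cartesian_product)
qed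

lemma hs_inner_add_right:
  "X \<in> carrier_mat n n \<Longrightarrow> Y \<in> carrier_mat n n \<Longrightarrow> Z \<in> carrier_mat n n \<Longrightarrow>
   hs_inner X (Y + Z) = hs_inner X Y + hs_inner X Z"
  by (simp add: hs_inner_sum[of _ n] ring_distribs sum.distrib)

lemma hs_inner_smult_right:
  "X \<in> carrier_mat n n \<Longrightarrow> Y \<in> carrier_mat n n \<Longrightarrow> hs_inner X (c \<cdot>\<^sub>m Y) = c * hs_inner X Y"
  by (simp add: hs_inner_sum[of _ n] sum_distrib_left mult.left_commute)

lemma hs_adjoint:
  assumes F: "linear_map n m F" and Y: "Y \<in> carrier_mat m m"
  shows hs_adjoint_carrier: "hs_adjoint n m F Y \<in> carrier_mat n n"
    and hs_adjoint_inner: "X \<in> carrier_mat n n \<Longrightarrow>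
          hs_inner (hs_adjoint n m F Y) X = hs_inner Y (F X)"
proof -
  let ?P = "\<lambda>Z. Z \<in> carrier_mat n n \<and> (\<forall>X\<in>carrier_mat n n. hs_inner Z X = hs_inner Y (F X))"
  define Z where "Z = mat n n (\<lambda>(i, j). cnj (hs_inner Y (F (elem_mat n i j))))"
  have Zc: "Z \<in> carrier_mat n n" by (simp add: Z_def)
  have "hs_inner Z X = hs_inner Y (F X)" if X: "X \<in> carrier_mat n n" for X
  proof -
    have "hs_inner Y (F X) = (\<Sum>i<n. \<Sum>j<n. X $$ (i, j) * hs_inner Y (F (elem_mat n i j)))"
      using F X Y unfolding linear_map_def
      by (intro linear_functional_rep)
         (auto simp: hs_inner_add_right[of _ m] hs_inner_smult_right[of _ m])
    also have "\<dots> = hs_inner Z X"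
      unfolding hs_inner_sum[OF Zc X] by (auto simp: Z_def mult.commute intro!: sum.cong)
    finally show ?thesis by simp
  qed
  then have "?P Z" using Zc by blast
  moreover have "Z1 = Z" if "?P Z1" for Z1
    using that \<open>?P Z\<close> by (intro hs_inner_eqI[of _ n]) auto
  ultimately have "?P (hs_adjoint n m F Y)"
    unfolding hs_adjoint_def by (rule theI)
  then show "hs_adjoint n m F Y \<in> carrier_mat n n"
    and "X \<in> carrier_mat n n \<Longrightarrow> hs_inner (hs_adjoint n m F Y) X = hs_inner Y (F X)"
    by auto
qed

lemma hs_adjoint_linear:
  assumes F: "linear_map n m F"
  shows "linear_map m n (hs_adjoint n m F)"
proof -
  let ?A = "hs_adjoint n m F"
  have c: "?A Y \<in> carrier_mat n n" if "Y \<in> carrier_mat m m" for Y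
    using hs_adjoint_carrier[OF F that] .
  have inner: "hs_inner X (?A Y) = hs_inner (F X) Y"
    if "X \<in> carrier_mat n n" "Y \<in> carrier_mat m m" for X Y
    using that hs_adjoint_inner[OF F] linear_map_carrier[OF F] c
    by (metis hs_inner_conj)
  have ext: "Z = Z'" if "Z \<in> carrier_mat n n" "Z' \<in> carrier_mat n n"
    "\<And>X. X \<in> carrier_mat n n \<Longrightarrow> hs_inner X Z = hs_inner X Z'" for Z Z'
    using that by (intro hs_inner_eqI[of _ n]) (metis hs_inner_conj)+
  have "?A (Y + Z) = ?A Y + ?A Z" if "Y \<in> carrier_mat m m" "Z \<in> carrier_mat m m" for Y Z
    using that c by (intro ext)
      (auto simp: inner hs_inner_add_right[of _ n] hs_inner_add_right[of _ m]
        linear_map_carrier[OF F])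
  moreover have "?A (a \<cdot>\<^sub>m Y) = a \<cdot>\<^sub>m ?A Y" if "Y \<in> carrier_mat m m" for a Y
    using that c by (intro ext)
      (auto simp: inner hs_inner_smult_right[of _ n] hs_inner_smult_right[of _ m]
        linear_map_carrier[OF F])
  ultimately show ?thesis using c by (simp add: linear_map_def)
qed

lemma hs_adjoint_adjoint_inner:
  assumes F: "linear_map n m F" and "X \<in> carrier_mat n n" "Y \<in> carrier_mat m m"
  shows "hs_inner (F X) Y = hs_inner X (hs_adjoint n m F Y)"
  using assms hs_adjoint_inner[OF F] linear_map_carrier[OF F] hs_adjoint_carrier[OF F]
  by (metis hs_inner_conj)

lemma pair_index_less: "a < n \<Longrightarrow> p < k \<Longrightarrow> a * k + p < n * (k::nat)"
proof -
  assume "a < n" "p < k"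
  then have "a * k + p < Suc a * k" by simp
  also have "\<dots> \<le> n * k" using \<open>a < n\<close> by (intro mult_le_mono1) simp
  finally show ?thesis .
qed

lemma sum_pair_index:
  fixes g :: "nat \<Rightarrow> complex"
  shows "(\<Sum>i<n * k. g i) = (\<Sum>p<k. \<Sum>a<n. g (a * k + p))"
proof -
  have "(\<Sum>i<n * k. g i) = (\<Sum>a<n. \<Sum>p<k. g (a * k + p))"
    using sum.nat_group[of g k n] by (simp add: sum.shift_bounds_nat_ivl[of _ 0, simplified]
      atLeast0LessThan[symmetric] add.commute)
  then show ?thesis by (subst sum.swap) simp
qed

lemma block_carrier [simp]: "block n k X p q \<in> carrier_mat n n"
  by (simp add: block_def)

lemma tensor_id_carrier [simp]: "tensor_id n m k F X \<in> carrier_mat (m * k) (m * k)"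
  by (simp add: tensor_id_def)

lemma block_tensor_id:
  assumes F: "linear_map n m F" and "p < k" "q < k"
  shows "block m k (tensor_id n m k F X) p q = F (block n k X p q)"
  using linear_map_carrier[OF F block_carrier, of k X p q] assms(2,3)
  by (intro eq_matI) (auto simp: block_def tensor_id_def pair_index_less)

lemma hs_inner_blocks:
  assumes "X \<in> carrier_mat (n * k) (n * k)" "Y \<in> carrier_mat (n * k) (n * k)"
  shows "hs_inner X Y = (\<Sum>p<k. \<Sum>q<k. hs_inner (block n k X p q) (block n k Y p q))"
proof -
  have "hs_inner X Y = (\<Sum>p<k. \<Sum>a<n. \<Sum>q<k. \<Sum>b<n.
      cnj (X $$ (a * k + p, b * k + q)) * Y $$ (a * k + p, b * k + q))"
    unfolding hs_inner_sum[OF assms] sum_pair_index ..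
  also have "\<dots> = (\<Sum>p<k. \<Sum>q<k. \<Sum>a<n. \<Sum>b<n.
      cnj (X $$ (a * k + p, b * k + q)) * Y $$ (a * k + p, b * k + q))"
    by (intro sum.cong refl sum.swap)
  also have "\<dots> = (\<Sum>p<k. \<Sum>q<k. hs_inner (block n k X p q) (block n k Y p q))"
    by (intro sum.cong refl, subst hs_inner_sum[of _ n])
       (auto simp: block_def intro!: sum.cong)
  finally show ?thesis .
qed

lemma tensor_id_adjoint_inner:
  assumes F: "linear_map n m F"
    and X: "X \<in> carrier_mat (n * k) (n * k)" and Y: "Y \<in> carrier_mat (m * k) (m * k)"
  shows "hs_inner (tensor_id n m k F X) Y = hs_inner X (tensor_id m n k (hs_adjoint n m F) Y)"
  using F X Y
  by (auto simp: hs_inner_blocks[of _ m k] hs_inner_blocks[of _ n k] block_tensor_id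
      hs_adjoint_linear hs_adjoint_adjoint_inner intro!: sum.cong)

lemma tensor_id_kron:
  assumes F: "linear_map n m F" and X: "X \<in> carrier_mat n n" and Y: "Y \<in> carrier_mat k k"
  shows "tensor_id n m k F (kron X Y) = kron (F X) Y"
proof (cases "k = 0")
  case True
  then show ?thesis using X Y linear_map_carrier[OF F X]
    by (intro eq_matI) (auto simp: tensor_id_def kron_def)
next
  case False
  have b: "block n k (kron X Y) p q = Y $$ (p, q) \<cdot>\<^sub>m X" if "p < k" "q < k" for p q
    using X Y that by (intro eq_matI) (auto simp: block_def kron_def pair_index_less)
  have "F (Y $$ (p, q) \<cdot>\<^sub>m X) = Y $$ (p, q) \<cdot>\<^sub>m F X" for p q
    using F X by (simp add: linear_map_def)
  moreover have "dim_row (kron (F X) Y) = m * k" "dim_col (kron (F X) Y) = m * k"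
    using Y linear_map_carrier[OF F X] by (auto simp: kron_def)
  moreover have "tensor_id n m k F (kron X Y) $$ (i, j) = kron (F X) Y $$ (i, j)"
    if "i < m * k" "j < m * k" for i j
  proof -
    have "i mod k < k" "j mod k < k" "i div k < m" "j div k < m"
      using False that by (auto simp: less_mult_imp_div_less)
    moreover have "kron (F X) Y $$ (i, j) = F X $$ (i div k, j div k) * Y $$ (i mod k, j mod k)"
      using that Y linear_map_carrier[OF F X] by (simp add: kron_def)
    ultimately show ?thesis
      using that linear_map_carrier[OF F X]
        \<open>\<And>p q. F (Y $$ (p, q) \<cdot>\<^sub>m X) = Y $$ (p, q) \<cdot>\<^sub>m F X\<close>
      by (simp add: tensor_id_def b)
  qed
  ultimately show ?thesis by (intro eq_matI) (auto simp: tensor_id_def)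
qed

lemma realized_adjoint_inner:
  assumes r: "realizes A B k Fe Fd f" and E: "linear_map (hdim A) (hdim A) E"
    and X: "X \<in> carrier_mat (hdim B) (hdim B)" and Y: "Y \<in> carrier_mat (hdim B) (hdim B)"
  shows "realized_adjoint A B k Fe Fd E Y \<in> carrier_mat (hdim B) (hdim B)"
    and "hs_inner X (realized_adjoint A B k Fe Fd E Y) =
         hs_inner (f (hs_adjoint (hdim A) (hdim A) E) X) Y"
proof -
  let ?a = "hdim A" and ?b = "hdim B"
  let ?E = "hs_adjoint ?a ?a E"
  have Fe: "linear_map ?b (?a * k) Fe" and Fd: "linear_map (?a * k) ?b Fd"
    using r by (auto simp: realizes_def cptp_def)
  note E' = hs_adjoint_linear[OF E]
  let ?Y = "hs_adjoint (?a * k) ?b Fd Y"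
  have Y': "?Y \<in> carrier_mat (?a * k) (?a * k)" using hs_adjoint_carrier[OF Fd Y] .
  have FX: "Fe X \<in> carrier_mat (?a * k) (?a * k)" using linear_map_carrier[OF Fe X] .
  show "realized_adjoint A B k Fe Fd E Y \<in> carrier_mat ?b ?b"
    using hs_adjoint_carrier[OF Fe] by (simp add: realized_adjoint_def)
  have EE: "tensor_id ?a ?a k (hs_adjoint ?a ?a ?E) Z = tensor_id ?a ?a k E Z" for Z
  proof -
    have "hs_adjoint ?a ?a ?E W = E W" if W: "W \<in> carrier_mat ?a ?a" for W
      using hs_adjoint_carrier[OF E' W] linear_map_carrier[OF E W]
        hs_adjoint_inner[OF E' W] hs_adjoint_adjoint_inner[OF E W]
      by (intro hs_inner_eqI[of _ ?a]) auto
    then show ?thesis by (simp add: tensor_id_def)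
  qed
  have "hs_inner X (realized_adjoint A B k Fe Fd E Y) =
      hs_inner (Fe X) (tensor_id ?a ?a k E ?Y)"
    by (simp add: realized_adjoint_def hs_adjoint_adjoint_inner[OF Fe X])
  also have "\<dots> = hs_inner (tensor_id ?a ?a k ?E (Fe X)) ?Y"
    using tensor_id_adjoint_inner[OF E' FX Y'] by (simp add: EE)
  also have "\<dots> = hs_inner (Fd (tensor_id ?a ?a k ?E (Fe X))) Y"
    by (simp add: hs_adjoint_adjoint_inner[OF Fd _ Y])
  also have "Fd (tensor_id ?a ?a k ?E (Fe X)) = f ?E X"
    using r E' X by (simp add: realizes_def)
  finally show "hs_inner X (realized_adjoint A B k Fe Fd E Y) = hs_inner (f ?E X) Y" .
qed

theorem superchannel_adjoint_eq:
  assumes r: "realizes A B k Fe Fd f" and E: "linear_map (hdim A) (hdim A) E"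
    and Y: "Y \<in> carrier_mat (hdim B) (hdim B)"
  shows "superchannel_adjoint A B f E Y = realized_adjoint A B k Fe Fd E Y"
proof -
  let ?P = "\<lambda>g. \<exists>k Fe Fd. realizes A B k Fe Fd f \<and> g = realized_adjoint A B k Fe Fd"
  have "\<exists>g. ?P g" using r by blast
  then have "?P (superchannel_adjoint A B f)"
    unfolding superchannel_adjoint_def by (rule someI_ex)
  then obtain k' Fe' Fd' where r': "realizes A B k' Fe' Fd' f"
    and eq: "superchannel_adjoint A B f = realized_adjoint A B k' Fe' Fd'" by blast
  have "realized_adjoint A B k' Fe' Fd' E Y = realized_adjoint A B k Fe Fd E Y"
  proof (rule hs_inner_eqI[of _ "hdim B"])
    fix X :: "complex mat" assume X: "X \<in> carrier_mat (hdim B) (hdim B)"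
    show "hs_inner (realized_adjoint A B k' Fe' Fd' E Y) X
        = hs_inner (realized_adjoint A B k Fe Fd E Y) X"
      using realized_adjoint_inner[OF r E X Y] realized_adjoint_inner[OF r' E X Y] X
      by (metis hs_inner_conj)
  qed (use realized_adjoint_inner(1)[OF r E Y Y] realized_adjoint_inner(1)[OF r' E Y Y] in auto)
  then show ?thesis using eq by simp
qed

lemma conj_sprod:
  assumes "u \<in> carrier_vec n" "v \<in> carrier_vec n"
  shows "conjugate u \<bullet>c conjugate v = cnj (u \<bullet>c (v::complex vec))"
  using assms by (simp add: scalar_prod_def)

lemma antiunitary_conjugate: "antiunitary n conjugate"
proof -
  have "v \<in> conjugate ` carrier_vec n" if "v \<in> carrier_vec n" for v :: "complex vec"
    using that by (intro image_eqI[of _ _ "conjugate v"]) auto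
  moreover have "conjugate (u + v) = conjugate u + conjugate v"
    if "u \<in> carrier_vec n" "v \<in> carrier_vec n" for u v :: "complex vec"
    using conjugate_add_vec[OF that] .
  moreover have "conjugate (c \<cdot>\<^sub>v v) = cnj c \<cdot>\<^sub>v conjugate v" for c and v :: "complex vec"
    by (simp add: conjugate_smult_vec)
  ultimately show ?thesis unfolding antiunitary_def using conj_sprod by auto
qed

lemma valid_conj_system: "d \<ge> 1 \<Longrightarrow> valid_system (conj_system d)"
  by (simp add: valid_system_def conj_system_def antiunitary_conjugate)

lemma anti_adjoint_conjugate:
  assumes w: "w \<in> carrier_vec n"
  shows "anti_adjoint n conjugate w = conjugate w"
  unfolding anti_adjoint_def
proof (rule the_equality)
  show "conjugate w \<in> carrier_vec n \<and>
      (\<forall>v\<in>carrier_vec n. v \<bullet>c conjugate w = cnj (conjugate v \<bullet>c w))"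
    using w conj_sprod[of _ n "conjugate w"] by (auto simp: conj_sprod[symmetric])
next
  fix u assume u: "u \<in> carrier_vec n \<and> (\<forall>v\<in>carrier_vec n. v \<bullet>c u = cnj (conjugate v \<bullet>c w))"
  show "u = conjugate w"
  proof (rule eq_vecI)
    fix i assume "i < dim_vec (conjugate w)"
    then have i: "i < n" using w by auto
    have "conjugate (unit_vec n i :: complex vec) = unit_vec n i"
      by (intro eq_vecI) (auto simp: unit_vec_def)
    then have "unit_vec n i \<bullet>c u = cnj (unit_vec n i \<bullet>c w)"
      using u by (metis unit_vec_carrier)
    then show "u $ i = conjugate w $ i" using u w i by (metis carrier_vec_conjugate conjugate_complex_def
        conjugate_vec_sprod_comm scalar_prod_left_unit unit_vec_carrier vec_index_conjugate
        carrier_vecD complex_cnj_cancel_iff)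
  qed (use u w in auto)
qed

lemma Ad_anti_conjugate:
  assumes T: "\<And>v. v \<in> carrier_vec n \<Longrightarrow> T v = conjugate v" and X: "X \<in> carrier_mat n n"
  shows "Ad_anti n T X = map_mat cnj X"
proof -
  have "anti_adjoint n T w = anti_adjoint n conjugate w" for w
    unfolding anti_adjoint_def using T by (intro arg_cong[of _ _ The] ext) auto
  then have "Ad_anti n T X $$ (i, j) = cnj (X $$ (i, j))" if "i < n" "j < n" for i j
  proof -
    have "conjugate (unit_vec n j :: complex vec) = unit_vec n j"
      by (intro eq_vecI) (auto simp: unit_vec_def)
    then show ?thesis
      using that X T \<open>\<And>w. anti_adjoint n T w = anti_adjoint n conjugate w\<close>
      by (simp add: Ad_anti_def anti_adjoint_conjugate)
  qed
  then show ?thesis using X by (intro eq_matI) (auto simp: Ad_anti_def)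
qed

end

theory Submission
  imports Defs
begin

text \<open>
  The channel \<open>Ad G\<close> and its time reversal \<open>Ad G\<^sup>T\<close> are perfectly distinguishable, since
  \<open>tr (G\<^sup>\<dagger> G\<^sup>T) = 0\<close>.  The superchannel probes its argument with half of a maximally entangled pair
  and applies \<open>E\<close> on the outcome \<open>G\<close> and the time reversal of \<open>E\<close>, which is a channel because \<open>E\<close>
  is unital, on the outcome \<open>G\<^sup>T\<close>.  Time reversal of the argument acts on its Choi operator as the
  swap of input and output, so T-symmetry requires the two effects to be swapped into each other.
  This is arranged by adding to the projections onto the vectorizations of \<open>G\<close> and \<open>G\<^sup>T\<close> half of
  the projection onto the orthogonal complement of both.  The maximally entangled probe is needed:
  with any other one the reversed tester would not be normalized.
\<close>


section \<open>Positive operators\<close>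

text \<open>Vectors are plain functions, so quantifying over \<open>v\<close> carries no carrier
  condition; values from \<open>n\<close> on are never read.\<close>

definition qform :: "nat \<Rightarrow> complex mat \<Rightarrow> (nat \<Rightarrow> complex) \<Rightarrow> complex" where
  "qform n X v = (\<Sum>i<n. \<Sum>j<n. cnj (v i) * X $$ (i, j) * v j)"

lemma qform_vec:
  assumes "X \<in> carrier_mat n n" "v \<in> carrier_vec n"
  shows "(X *\<^sub>v v) \<bullet>c v = qform n X (\<lambda>i. v $ i)"
  using assms unfolding qform_def
  by (auto simp: scalar_prod_def atLeast0LessThan sum_distrib_left sum_distrib_right mult_ac
      intro!: sum.cong)

lemma positive_op_iff:
  "positive_op n X \<longleftrightarrow> X \<in> carrier_mat n n \<and> (\<forall>v. qform n X v \<ge> 0)"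
proof -
  have "qform n X v \<ge> 0" if "X \<in> carrier_mat n n" "\<forall>w\<in>carrier_vec n. (X *\<^sub>v w) \<bullet>c w \<ge> 0" for v
  proof -
    have "qform n X v = qform n X (\<lambda>i. vec n v $ i)"
      by (auto simp: qform_def intro!: sum.cong)
    then show ?thesis using that(2) qform_vec[OF that(1), of "vec n v"] by (metis vec_carrier)
  qed
  then show ?thesis unfolding positive_op_def by (auto simp: qform_vec)
qed

lemma qform_unit:
  assumes "i < n"
  shows "qform n X (\<lambda>l. if l = i then 1 else 0) = X $$ (i, i)"
proof -
  have "qform n X (\<lambda>l. if l = i then 1 else 0)
      = (\<Sum>l<n. \<Sum>j<n. if j = i then (if l = i then X $$ (l, j) else 0) else 0)"
    unfolding qform_def by (intro sum.cong refl) simp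
  then show ?thesis using assms by simp
qed

text \<open>Perturbing one coordinate serves twice: from a unit vector it yields the two-coordinate
  test vectors, from an arbitrary \<open>v\<close> it completes the square in the Cholesky
  step.\<close>

lemma qform_shift:
  assumes "i < n"
  shows "qform n X (\<lambda>l. v l + (if l = i then t else 0)) =
    qform n X v + t * (\<Sum>l<n. cnj (v l) * X $$ (l, i)) + cnj t * (\<Sum>l<n. X $$ (i, l) * v l)
      + cnj t * t * X $$ (i, i)"
proof -
  have "qform n X (\<lambda>l. v l + (if l = i then t else 0)) =
     (\<Sum>l<n. \<Sum>j<n. cnj (v l) * X $$ (l, j) * v j
       + (if j = i then t * (cnj (v l) * X $$ (l, j)) else 0)
       + (if l = i then cnj t * (X $$ (l, j) * v j) else 0)
       + (if l = i then (if j = i then cnj t * t * X $$ (l, j) else 0) else 0))"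
    unfolding qform_def by (intro sum.cong refl) (simp add: ring_distribs)
  also have "\<dots> = qform n X v
      + (\<Sum>l<n. \<Sum>j<n. (if j = i then t * (cnj (v l) * X $$ (l, j)) else 0))
      + (\<Sum>j<n. \<Sum>l<n. (if l = i then cnj t * (X $$ (l, j) * v j) else 0))
      + (\<Sum>j<n. \<Sum>l<n. (if l = i then (if j = i then cnj t * t * X $$ (l, j) else 0) else 0))"
    unfolding sum.distrib qform_def
      sum.swap[of "\<lambda>j l. if l = i then cnj t * (X $$ (l, j) * v j) else 0"]
      sum.swap[of "\<lambda>j l. if l = i then (if j = i then cnj t * t * X $$ (l, j) else 0) else 0"] ..
  also have "\<dots> = qform n X v + t * (\<Sum>l<n. cnj (v l) * X $$ (l, i))
      + cnj t * (\<Sum>l<n. X $$ (i, l) * v l) + cnj t * t * X $$ (i, i)"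
    using assms by (simp add: sum_distrib_left)
  finally show ?thesis .
qed

lemma qform_two_units:
  assumes "i < n" "j < n"
  shows "qform n X (\<lambda>l. (if l = i then 1 else 0) + (if l = j then t else 0)) =
    X $$ (i, i) + t * X $$ (i, j) + cnj t * X $$ (j, i) + cnj t * t * X $$ (j, j)"
proof -
  have "(\<Sum>l<n. cnj (if l = i then 1 else 0) * X $$ (l, j)) = (\<Sum>l<n. if l = i then X $$ (l, j) else 0)"
    "(\<Sum>l<n. X $$ (j, l) * (if l = i then 1 else 0)) = (\<Sum>l<n. if l = i then X $$ (j, l) else 0)"
    by (intro sum.cong refl; simp)+
  then show ?thesis unfolding qform_shift[OF assms(2)] qform_unit[OF assms(1)]
    using assms by simp
qed

lemma positive_op_diag:
  assumes "positive_op n X" "i < n"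
  shows "X $$ (i, i) \<ge> 0"
proof -
  have "qform n X (\<lambda>l. if l = i then 1 else 0) \<ge> 0"
    using assms(1) unfolding positive_op_iff by blast
  then show ?thesis unfolding qform_unit[OF assms(2)] .
qed

lemma positive_op_two_units:
  assumes "positive_op n X" "i < n" "j < n"
  shows "X $$ (i, i) + t * X $$ (i, j) + cnj t * X $$ (j, i) + cnj t * t * X $$ (j, j) \<ge> 0"
proof -
  have "qform n X (\<lambda>l. (if l = i then 1 else 0) + (if l = j then t else 0)) \<ge> 0"
    using assms(1) unfolding positive_op_iff by blast
  then show ?thesis unfolding qform_two_units[OF assms(2,3)] .
qed

lemma positive_op_hermitian:
  assumes "positive_op n X" "i < n" "j < n"
  shows "X $$ (j, i) = cnj (X $$ (i, j))"
proof -
  have "Im (X $$ (i, i)) = 0" "Im (X $$ (j, j)) = 0"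
    using positive_op_diag[OF assms(1,2)] positive_op_diag[OF assms(1,3)]
    by (simp_all add: less_eq_complex_def)
  \<comment> \<open>A nonnegative complex number is real. For \<open>t = 1\<close> this relates the
    imaginary parts, for \<open>t = \<i>\<close> the real parts.\<close>
  then have "Im (X $$ (j, i)) = - Im (X $$ (i, j))" "Re (X $$ (j, i)) = Re (X $$ (i, j))"
    using positive_op_two_units[OF assms, of 1] positive_op_two_units[OF assms, of \<i>]
    by (simp_all add: less_eq_complex_def)
  then show ?thesis by (simp add: complex_eq_iff)
qed

text \<open>With both diagonal entries zero the test vectors leave only twice the real part of
  \<open>t * X $$ (i, j)\<close>; the four units \<open>1\<close>, \<open>-1\<close>,
  \<open>\<i>\<close>, \<open>-\<i>\<close> force both parts to vanish.\<close>

lemma positive_op_diag_zero: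
  assumes "positive_op n X" "i < n" "j < n" "X $$ (i, i) = 0" "X $$ (j, j) = 0"
  shows "X $$ (i, j) = 0"
proof -
  note two = positive_op_two_units[OF assms(1-3)]
  have "Re (X $$ (i, j)) = 0" "Im (X $$ (i, j)) = 0"
    using two[of 1] two[of "-1"] two[of \<i>] two[of "-\<i>"] assms(4,5)
    by (simp_all add: positive_op_hermitian[OF assms(1-3)] less_eq_complex_def)
  then show ?thesis by (simp add: complex_eq_iff)
qed

section \<open>Rank-one operators and self-duality of the positive cone\<close>

definition rank_one :: "nat \<Rightarrow> (nat \<Rightarrow> complex) \<Rightarrow> complex mat" where
  "rank_one n v = mat n n (\<lambda>(i, j). v i * cnj (v j))"

lemma rank_one_carrier [simp]: "rank_one n v \<in> carrier_mat n n"
  by (simp add: rank_one_def)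

lemma hs_inner_rank_one:
  "X \<in> carrier_mat n n \<Longrightarrow> hs_inner (rank_one n v) X = qform n X v"
  by (simp add: hs_inner_sum[of _ n] qform_def rank_one_def mult_ac)

lemma cnj_mult_nonneg: "cnj z * (z::complex) \<ge> 0"
  by (simp add: less_eq_complex_def)

lemma qform_rank_one:
  "qform n (rank_one n w) v = cnj (\<Sum>i<n. cnj (w i) * v i) * (\<Sum>i<n. cnj (w i) * v i)"
  unfolding qform_def rank_one_def by (simp add: sum_product) (simp add: mult_ac)

lemma positive_rank_one: "positive_op n (rank_one n v)"
  unfolding positive_op_iff qform_rank_one by (intro conjI allI cnj_mult_nonneg rank_one_carrier)

lemma qform_minus:
  "X \<in> carrier_mat n n \<Longrightarrow> Y \<in> carrier_mat n n \<Longrightarrow>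
   qform n (X - c \<cdot>\<^sub>m Y) v = qform n X v - c * qform n Y v"
  by (simp add: qform_def algebra_simps sum_subtractf sum_distrib_left)

text \<open>Up to a zero row and column, \<open>P'\<close> is the Schur complement of the pivot. Its
  form at \<open>v\<close> is the form of \<open>P\<close> after shifting coordinate
  \<open>i\<close> of \<open>v\<close> by \<open>- s / c\<close>, the shift that minimizes the
  form.\<close>

lemma positive_op_cholesky_step:
  fixes P :: "complex mat"
  assumes P: "positive_op n P" and i: "i < n" and nz: "P $$ (i, i) \<noteq> 0"
  defines "P' \<equiv> P - (1 / P $$ (i, i)) \<cdot>\<^sub>m rank_one n (\<lambda>l. P $$ (l, i))"
  shows "positive_op n P'"
proof -
  have Pc: "P \<in> carrier_mat n n" using P by (simp add: positive_op_iff)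
  have "qform n P' v \<ge> 0" for v
  proof -
    define s where "s = (\<Sum>l<n. P $$ (i, l) * v l)"
    define c where "c = P $$ (i, i)"
    have c: "cnj c = c" using positive_op_hermitian[OF P i i] by (simp add: c_def)
    have s': "(\<Sum>l<n. cnj (v l) * P $$ (l, i)) = cnj s"
      using positive_op_hermitian[OF P i] by (auto simp: s_def mult.commute intro!: sum.cong)
    have "(\<Sum>l<n. cnj (P $$ (l, i)) * v l) = s"
      using positive_op_hermitian[OF P i] by (auto simp: s_def intro!: sum.cong)
    then have "qform n P' v = qform n P v - cnj s * s / c"
      unfolding P'_def qform_minus[OF Pc rank_one_carrier] qform_rank_one by (simp add: c_def)
    also have "\<dots> = qform n P (\<lambda>l. v l + (if l = i then - s / c else 0))"
    proof -
      have "c \<noteq> 0" using nz by (simp add: c_def)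
      then have "- s / c * cnj s + - cnj s / c * s + - cnj s / c * (- s / c) * c = - (cnj s * s / c)"
        by simp
      moreover have "cnj (- s / c) = - cnj s / c" using c by simp
      ultimately show ?thesis
        unfolding qform_shift[OF i] s' s_def[symmetric] c_def[symmetric] by (simp add: add.assoc)
    qed
    also have "\<dots> \<ge> 0" using P by (simp add: positive_op_iff)
    finally show ?thesis .
  qed
  then show ?thesis unfolding positive_op_iff P'_def using Pc by (simp add: minus_carrier_mat)
qed

text \<open>Pivoting replaces a spectral decomposition: each step peels off a rank-one term of
  positive weight, which contributes a value of the form of \<open>Q\<close>. The number of nonzero
  diagonal entries of \<open>P\<close> drops each time; once none is left, \<open>P\<close>
  vanishes.\<close>

lemma hs_inner_nonneg:
  assumes "positive_op n P" "positive_op n Q"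
  shows "hs_inner P Q \<ge> 0"
  using assms(1)
proof (induction "card {i. i < n \<and> P $$ (i, i) \<noteq> 0}" arbitrary: P rule: less_induct)
  case less
  note P = less.prems
  have Pc: "P \<in> carrier_mat n n" and Qc: "Q \<in> carrier_mat n n"
    using P assms(2) by (auto simp: positive_op_iff)
  show ?case
  proof (cases "\<exists>i<n. P $$ (i, i) \<noteq> 0")
    case False
    then have "P $$ (i, j) = 0" if "i < n" "j < n" for i j
      using positive_op_diag_zero[OF P that] that by blast
    then show ?thesis by (simp add: hs_inner_sum[OF Pc Qc])
  next
    case True
    then obtain i where i: "i < n" "P $$ (i, i) \<noteq> 0" by blast
    define c where "c = P $$ (i, i)"
    define w where "w = (\<lambda>l. P $$ (l, i))"
    define P' where "P' = P - (1 / c) \<cdot>\<^sub>m rank_one n w"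
    have P': "positive_op n P'"
      using positive_op_cholesky_step[OF P i] by (simp add: P'_def w_def c_def)
    have c: "c \<ge> 0" "cnj c = c" "c \<noteq> 0"
      using positive_op_diag[OF P i(1)] positive_op_hermitian[OF P i(1) i(1)] i(2)
      by (auto simp: c_def)
    then have ic: "1 / c \<ge> 0"
      by (auto simp: less_eq_complex_def complex_eq_iff Re_divide Im_divide)
    have P'_diag: "P' $$ (j, j) = P $$ (j, j) - 1 / c * (w j * cnj (w j))" if "j < n" for j
      using that Pc by (simp add: P'_def rank_one_def)
    \<comment> \<open>Zero diagonal entries stay zero: the subtraction can only lower them, while
      positivity of \<open>P'\<close> keeps them nonnegative.\<close>
    have "P' $$ (j, j) = 0" if j: "j < n" "P $$ (j, j) = 0" for j
    proof -
      have "1 / c * (cnj (w j) * w j) \<ge> 0" using ic cnj_mult_nonneg by (rule mult_nonneg_nonneg)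
      then have "P' $$ (j, j) \<le> 0" using P'_diag[OF j(1)] j(2)
        by (simp add: mult.commute less_eq_complex_def)
      then show ?thesis using positive_op_diag[OF P' j(1)] by simp
    qed
    moreover have "P' $$ (i, i) = 0"
      using P'_diag[OF i(1)] c by (simp add: w_def c_def[symmetric])
    ultimately have "{j. j < n \<and> P' $$ (j, j) \<noteq> 0} \<subset> {j. j < n \<and> P $$ (j, j) \<noteq> 0}"
      using i by blast
    then have IH: "hs_inner P' Q \<ge> 0"
      by (intro less.hyps P' psubset_card_mono) auto
    have P'c: "P' \<in> carrier_mat n n" using P' by (simp add: positive_op_iff)
    have "hs_inner P Q = hs_inner P' Q + (1 / c) * hs_inner (rank_one n w) Q"
      unfolding hs_inner_sum[OF Pc Qc] hs_inner_sum[OF P'c Qc]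
        hs_inner_sum[OF rank_one_carrier Qc] sum_distrib_left sum.distrib[symmetric]
      using Pc c(2) by (intro sum.cong refl) (simp add: P'_def rank_one_def ring_distribs)
    also have "\<dots> \<ge> 0"
      using IH ic assms(2) unfolding hs_inner_rank_one[OF Qc] positive_op_iff
      by (intro add_nonneg_nonneg mult_nonneg_nonneg) auto
    finally show ?thesis .
  qed
qed


section \<open>Completely positive maps\<close>

lemma linear_mapI:
  assumes "\<And>X. X \<in> carrier_mat n n \<Longrightarrow> F X \<in> carrier_mat m m"
    and "\<And>X Y. X \<in> carrier_mat n n \<Longrightarrow> Y \<in> carrier_mat n n \<Longrightarrow> F (X + Y) = F X + F Y"
    and "\<And>c X. X \<in> carrier_mat n n \<Longrightarrow> F (c \<cdot>\<^sub>m X) = c \<cdot>\<^sub>m F X"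
  shows "linear_map n m F"
  using assms by (simp add: linear_map_def)

lemma linear_map_add:
  "linear_map n m F \<Longrightarrow> X \<in> carrier_mat n n \<Longrightarrow> Y \<in> carrier_mat n n \<Longrightarrow> F (X + Y) = F X + F Y"
  by (simp add: linear_map_def)

lemma linear_map_smult:
  "linear_map n m F \<Longrightarrow> X \<in> carrier_mat n n \<Longrightarrow> F (c \<cdot>\<^sub>m X) = c \<cdot>\<^sub>m F X"
  by (simp add: linear_map_def)

lemma linear_map_comp:
  assumes F: "linear_map n m F" and G: "linear_map m l G"
  shows "linear_map n l (\<lambda>X. G (F X))"
  by (rule linear_mapI)
     (auto simp: linear_map_carrier[OF F] linear_map_carrier[OF G] linear_map_add[OF F]
       linear_map_add[OF G] linear_map_smult[OF F] linear_map_smult[OF G])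

lemma linear_map_sum:
  assumes F: "linear_map n m F" and G: "linear_map n m G"
  shows "linear_map n m (\<lambda>X. F X + G X)"
proof (rule linear_mapI)
  fix X Y :: "complex mat" and c
  assume X: "X \<in> carrier_mat n n"
  show "F X + G X \<in> carrier_mat m m"
    using linear_map_carrier[OF G X] by simp
  show "F (c \<cdot>\<^sub>m X) + G (c \<cdot>\<^sub>m X) = c \<cdot>\<^sub>m (F X + G X)"
    using linear_map_carrier[OF F X] linear_map_carrier[OF G X]
    unfolding linear_map_smult[OF F X] linear_map_smult[OF G X]
    by (intro eq_matI) (auto simp: ring_distribs)
  assume Y: "Y \<in> carrier_mat n n"
  show "F (X + Y) + G (X + Y) = F X + G X + (F Y + G Y)"
    using linear_map_carrier[OF F X] linear_map_carrier[OF G X]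
      linear_map_carrier[OF F Y] linear_map_carrier[OF G Y]
    unfolding linear_map_add[OF F X Y] linear_map_add[OF G X Y]
    by (intro eq_matI) auto
qed

lemma map_cnj_add:
  "X \<in> carrier_mat n m \<Longrightarrow> Y \<in> carrier_mat n m \<Longrightarrow>
   map_mat cnj (X + Y) = map_mat cnj X + map_mat cnj Y"
  by (intro eq_matI) auto

lemma map_cnj_smult: "map_mat cnj (c \<cdot>\<^sub>m X) = cnj c \<cdot>\<^sub>m map_mat cnj X"
  by (intro eq_matI) auto

lemma map_cnj_cnj [simp]: "map_mat cnj (map_mat cnj X) = X"
  by (intro eq_matI) auto

lemma linear_map_conj:
  assumes F: "linear_map n m F"
  shows "linear_map n m (\<lambda>X. map_mat cnj (F (map_mat cnj X)))"
proof (rule linear_mapI)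
  fix X Y :: "complex mat" and c
  assume X: "X \<in> carrier_mat n n"
  then have X': "map_mat cnj X \<in> carrier_mat n n" by simp
  show "map_mat cnj (F (map_mat cnj X)) \<in> carrier_mat m m"
    using linear_map_carrier[OF F X'] by simp
  show "map_mat cnj (F (map_mat cnj (c \<cdot>\<^sub>m X))) = c \<cdot>\<^sub>m map_mat cnj (F (map_mat cnj X))"
    by (simp add: map_cnj_smult linear_map_smult[OF F X'])
  assume Y: "Y \<in> carrier_mat n n"
  then have Y': "map_mat cnj Y \<in> carrier_mat n n" by simp
  show "map_mat cnj (F (map_mat cnj (X + Y)))
      = map_mat cnj (F (map_mat cnj X)) + map_mat cnj (F (map_mat cnj Y))"
    by (simp add: map_cnj_add[OF X Y] linear_map_add[OF F X' Y']
        map_cnj_add[OF linear_map_carrier[OF F X'] linear_map_carrier[OF F Y']])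
qed

section \<open>Single Kraus operators and closure of complete positivity\<close>

lemma linear_map_Ad:
  assumes K: "K \<in> carrier_mat m n"
  shows "linear_map n m (Ad K)"
proof (rule linear_mapI)
  note K' = mat_adjoint_carrier[OF K]
  fix X Y :: "complex mat" and c
  assume X: "X \<in> carrier_mat n n"
  show "Ad K X \<in> carrier_mat m m" unfolding Ad_def by (rule mult_carrier_mat[OF mult_carrier_mat[OF K X] K'])
  show "Ad K (c \<cdot>\<^sub>m X) = c \<cdot>\<^sub>m Ad K X"
    unfolding Ad_def mult_smult_distrib[OF K X]
    by (rule mult_smult_assoc_mat[OF _ K']) (use K X in auto)
  assume Y: "Y \<in> carrier_mat n n"
  show "Ad K (X + Y) = Ad K X + Ad K Y"
    unfolding Ad_def mult_add_distrib_mat[OF K X Y]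
    by (rule add_mult_distrib_mat[OF _ _ K']) (use K X Y in auto)
qed

lemma Ad_index:
  assumes K: "K \<in> carrier_mat m n" and X: "X \<in> carrier_mat n n" and "i < m" "j < m"
  shows "Ad K X $$ (i, j) = (\<Sum>a<n. \<Sum>b<n. K $$ (i, a) * X $$ (a, b) * cnj (K $$ (j, b)))"
proof -
  have "Ad K X $$ (i, j) = (\<Sum>b<n. \<Sum>a<n. K $$ (i, a) * X $$ (a, b) * cnj (K $$ (j, b)))"
    using assms carrier_matD[OF mat_adjoint_carrier[OF K]]
    by (simp add: Ad_def scalar_prod_def atLeast0LessThan mat_adjoint_index[OF K] sum_distrib_right)
  then show ?thesis by (subst sum.swap)
qed

lemma trace_carrier: "X \<in> carrier_mat n n \<Longrightarrow> mat_trace X = (\<Sum>i<n. X $$ (i, i))"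
  by (simp add: mat_trace_def)

lemma trace_add:
  "X \<in> carrier_mat n n \<Longrightarrow> Y \<in> carrier_mat n n \<Longrightarrow> mat_trace (X + Y) = mat_trace X + mat_trace Y"
  by (simp add: trace_carrier[of _ n] sum.distrib)

lemma sum_blocks_swap:
  "(\<Sum>p<k. \<Sum>a<n. \<Sum>q<l. \<Sum>b<m. g p a q b) = (\<Sum>p<k. \<Sum>q<l. \<Sum>a<n. \<Sum>b<m. (g p a q b :: complex))"
  by (rule sum.cong[OF refl], rule sum.swap)

lemma qform_blocks:
  "qform (n * k) X v
   = (\<Sum>p<k. \<Sum>q<k. \<Sum>a<n. \<Sum>b<n. cnj (v (a * k + p)) * block n k X p q $$ (a, b) * v (b * k + q))"
  unfolding qform_def sum_pair_index
  by (subst sum_blocks_swap, intro sum.cong refl) (simp add: block_def)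

text \<open>The Kraus operator moves onto the test vector: the form of the output at
  \<open>v\<close> is the form of \<open>X\<close> at
  \<open>(K\<^sup>\<dagger> \<otimes> 1) v\<close>.\<close>

lemma completely_positive_Ad:
  assumes K: "K \<in> carrier_mat m n"
  shows "completely_positive n m (Ad K)"
  unfolding completely_positive_def
proof (intro allI impI)
  fix k X assume X: "positive_op (n * k) X"
  have "qform (m * k) (tensor_id n m k (Ad K) X) v \<ge> 0" for v
  proof -
    \<comment> \<open>The coordinates of \<open>(K\<^sup>\<dagger> \<otimes> 1) v\<close>:
      \<open>i div k\<close> indexes the input space of \<open>K\<close>, \<open>i mod k\<close> the
      ancilla.\<close>
    define w where "w i = (\<Sum>a<m. cnj (K $$ (a, i div k)) * v (a * k + i mod k))" for i
    have w: "w (c * k + p) = (\<Sum>a<m. cnj (K $$ (a, c)) * v (a * k + p))" if "p < k" for c p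
      using that by (simp add: w_def)
    have "qform (n * k) X w = qform (m * k) (tensor_id n m k (Ad K) X) v"
      unfolding qform_blocks
    proof (rule sum.cong[OF refl], rule sum.cong[OF refl])
      fix p q assume "p \<in> {..<k}" "q \<in> {..<k}"
      then have p: "p < k" and q: "q < k" by auto
      define B where "B = block n k X p q"
      have Bc: "B \<in> carrier_mat n n" by (simp add: B_def)
      have "(\<Sum>c<n. \<Sum>e<n. cnj (w (c * k + p)) * B $$ (c, e) * w (e * k + q))
        = (\<Sum>c<n. \<Sum>e<n. \<Sum>a<m. \<Sum>b<m.
            cnj (v (a * k + p)) * (K $$ (a, c) * B $$ (c, e) * cnj (K $$ (b, e))) * v (b * k + q))"
        unfolding w[OF p] w[OF q]
        by (intro sum.cong refl) (simp add: sum_distrib_left sum_distrib_right mult_ac)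
      also have "\<dots> = (\<Sum>c<n. \<Sum>a<m. \<Sum>e<n. \<Sum>b<m.
            cnj (v (a * k + p)) * (K $$ (a, c) * B $$ (c, e) * cnj (K $$ (b, e))) * v (b * k + q))"
        by (intro sum.cong refl sum.swap)
      also have "\<dots> = (\<Sum>a<m. \<Sum>c<n. \<Sum>e<n. \<Sum>b<m.
            cnj (v (a * k + p)) * (K $$ (a, c) * B $$ (c, e) * cnj (K $$ (b, e))) * v (b * k + q))"
        by (rule sum.swap)
      also have "\<dots> = (\<Sum>a<m. \<Sum>c<n. \<Sum>b<m. \<Sum>e<n.
            cnj (v (a * k + p)) * (K $$ (a, c) * B $$ (c, e) * cnj (K $$ (b, e))) * v (b * k + q))"
        by (intro sum.cong refl sum.swap)
      also have "\<dots> = (\<Sum>a<m. \<Sum>b<m. \<Sum>c<n. \<Sum>e<n.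
            cnj (v (a * k + p)) * (K $$ (a, c) * B $$ (c, e) * cnj (K $$ (b, e))) * v (b * k + q))"
        by (intro sum.cong refl sum.swap)
      also have "\<dots> = (\<Sum>a<m. \<Sum>b<m. cnj (v (a * k + p)) * Ad K B $$ (a, b) * v (b * k + q))"
        by (intro sum.cong refl) (simp add: Ad_index[OF K Bc] sum_distrib_left sum_distrib_right)
      finally show "(\<Sum>c<n. \<Sum>e<n. cnj (w (c * k + p)) * block n k X p q $$ (c, e) * w (e * k + q))
        = (\<Sum>a<m. \<Sum>b<m. cnj (v (a * k + p))
            * block m k (tensor_id n m k (Ad K) X) p q $$ (a, b) * v (b * k + q))"
        unfolding block_tensor_id[OF linear_map_Ad[OF K] p q] B_def .
    qed
    moreover have "qform (n * k) X w \<ge> 0" using X unfolding positive_op_iff by blast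
    ultimately show ?thesis by simp
  qed
  then show "positive_op (m * k) (tensor_id n m k (Ad K) X)" by (simp add: positive_op_iff)
qed

lemma mod_less_of_less_mult: "i < m * k \<Longrightarrow> i mod k < (k::nat)"
  by (cases k) auto

lemma tensor_id_comp:
  assumes F: "linear_map n m F"
  shows "tensor_id n l k (\<lambda>X. G (F X)) X = tensor_id m l k G (tensor_id n m k F X)"
  by (intro eq_matI) (auto simp: tensor_id_def[of _ l] block_tensor_id[OF F] mod_less_of_less_mult)

lemma completely_positive_comp:
  assumes "completely_positive n m F" "completely_positive m l G" "linear_map n m F"
  shows "completely_positive n l (\<lambda>X. G (F X))"
  unfolding completely_positive_def tensor_id_comp[OF assms(3)]
  using assms(1,2) by (simp add: completely_positive_def)

lemma completely_positive_sum:
  assumes cp: "completely_positive n m F" "completely_positive n m G"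
    and F: "linear_map n m F" and G: "linear_map n m G"
  shows "completely_positive n m (\<lambda>X. F X + G X)"
  unfolding completely_positive_def
proof (intro allI impI)
  fix k X assume X: "positive_op (n * k) X"
  have "tensor_id n m k (\<lambda>X. F X + G X) X $$ (i, j)
      = tensor_id n m k F X $$ (i, j) + tensor_id n m k G X $$ (i, j)"
    if "i < m * k" "j < m * k" for i j
    using that carrier_matD[OF linear_map_carrier[OF G block_carrier]]
    by (simp add: tensor_id_def less_mult_imp_div_less)
  then have "qform (m * k) (tensor_id n m k (\<lambda>X. F X + G X) X) v
      = qform (m * k) (tensor_id n m k F X) v + qform (m * k) (tensor_id n m k G X) v" for v
    unfolding qform_def sum.distrib[symmetric] by (intro sum.cong refl) (simp add: ring_distribs)
  then show "positive_op (m * k) (tensor_id n m k (\<lambda>X. F X + G X) X)"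
    using cp X unfolding completely_positive_def positive_op_iff by simp
qed

lemma positive_op_conj:
  assumes "positive_op n X"
  shows "positive_op n (map_mat cnj X)"
proof -
  have X: "X \<in> carrier_mat n n" using assms by (simp add: positive_op_iff)
  have "qform n (map_mat cnj X) v = cnj (qform n X (\<lambda>i. cnj (v i)))" for v
    using X by (simp add: qform_def)
  then show ?thesis using assms X by (simp add: positive_op_iff less_eq_complex_def)
qed

text \<open>Entrywise conjugation commutes with taking blocks, so it passes through the extension by
  an ancilla, and it preserves positivity.\<close>

lemma completely_positive_conj:
  assumes cp: "completely_positive n m F" and F: "linear_map n m F"
  shows "completely_positive n m (\<lambda>X. map_mat cnj (F (map_mat cnj X)))"
  unfolding completely_positive_def
proof (intro allI impI)
  fix k X assume X: "positive_op (n * k) X"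
  have Xc: "X \<in> carrier_mat (n * k) (n * k)" using X by (simp add: positive_op_iff)
  have b: "map_mat cnj (block n k X p q) = block n k (map_mat cnj X) p q" if "p < k" "q < k" for p q
    using that Xc by (intro eq_matI) (auto simp: block_def pair_index_less)
  have "tensor_id n m k (\<lambda>X. map_mat cnj (F (map_mat cnj X))) X
      = map_mat cnj (tensor_id n m k F (map_mat cnj X))"
    using carrier_matD[OF linear_map_carrier[OF F block_carrier]]
    by (intro eq_matI) (auto simp: tensor_id_def b mod_less_of_less_mult less_mult_imp_div_less)
  then show "positive_op (m * k) (tensor_id n m k (\<lambda>X. map_mat cnj (F (map_mat cnj X))) X)"
    using cp positive_op_conj[OF X] positive_op_conj by (simp add: completely_positive_def)
qed

text \<open>The form of the output at \<open>v\<close> is the pairing of \<open>X\<close> with the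
  image of the rank-one operator of \<open>v\<close> under the extension of \<open>F\<close>; both
  are positive, so \<open>hs_inner_nonneg\<close> applies.\<close>

lemma completely_positive_hs_adjoint:
  assumes cp: "completely_positive n m F" and F: "linear_map n m F"
  shows "completely_positive m n (hs_adjoint n m F)"
  unfolding completely_positive_def
proof (intro allI impI)
  fix k X assume X: "positive_op (m * k) X"
  have Xc: "X \<in> carrier_mat (m * k) (m * k)" using X by (simp add: positive_op_iff)
  have "qform (n * k) (tensor_id m n k (hs_adjoint n m F) X) v \<ge> 0" for v
  proof -
    have "qform (n * k) (tensor_id m n k (hs_adjoint n m F) X) v
        = hs_inner (tensor_id n m k F (rank_one (n * k) v)) X"
      unfolding tensor_id_adjoint_inner[OF F rank_one_carrier Xc]
      by (rule hs_inner_rank_one[symmetric]) simp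
    also have "\<dots> \<ge> 0"
      using cp positive_rank_one X by (intro hs_inner_nonneg) (auto simp: completely_positive_def)
    finally show ?thesis .
  qed
  then show "positive_op (n * k) (tensor_id m n k (hs_adjoint n m F) X)"
    by (simp add: positive_op_iff)
qed


section \<open>Time reversal of unital channels\<close>

lemma hs_inner_one: "X \<in> carrier_mat n n \<Longrightarrow> hs_inner (1\<^sub>m n) X = mat_trace X"
proof -
  assume X: "X \<in> carrier_mat n n"
  have "hs_inner (1\<^sub>m n) X = (\<Sum>i<n. \<Sum>j<n. if j = i then X $$ (i, j) else 0)"
    unfolding hs_inner_sum[OF one_carrier_mat X] by (intro sum.cong refl) auto
  then show ?thesis using X by (simp add: trace_carrier)
qed

lemma trace_conj: "X \<in> carrier_mat n n \<Longrightarrow> mat_trace (map_mat cnj X) = cnj (mat_trace X)"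
  by (simp add: trace_carrier[of _ n])

lemma hs_inner_map_cnj:
  "X \<in> carrier_mat n n \<Longrightarrow> Y \<in> carrier_mat n n \<Longrightarrow>
   hs_inner (map_mat cnj X) (map_mat cnj Y) = cnj (hs_inner X Y)"
  by (simp add: hs_inner_sum[of _ n])

text \<open>The counterpart for channels of the reverse-process simulator, with
  \<open>\<theta>\<close> acting as entrywise conjugation.\<close>

definition time_reversal :: "nat \<Rightarrow> (complex mat \<Rightarrow> complex mat) \<Rightarrow> complex mat \<Rightarrow> complex mat" where
  "time_reversal d E X = map_mat cnj (hs_adjoint d d E (map_mat cnj X))"

lemma linear_time_reversal: "linear_map d d E \<Longrightarrow> linear_map d d (time_reversal d E)"
  unfolding time_reversal_def[abs_def] by (intro linear_map_conj hs_adjoint_linear)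

text \<open>The trace is the pairing with the identity, so passing to the adjoint turns unitality of
  \<open>E\<close> into trace preservation.\<close>

lemma cptp_time_reversal:
  assumes "cptp d d E" and unital: "E (1\<^sub>m d) = 1\<^sub>m d"
  shows "cptp d d (time_reversal d E)"
proof -
  have E: "linear_map d d E" and cp: "completely_positive d d E"
    using assms(1) by (auto simp: cptp_def)
  have "mat_trace (time_reversal d E X) = mat_trace X" if X: "X \<in> carrier_mat d d" for X
  proof -
    have X': "map_mat cnj X \<in> carrier_mat d d" using X by simp
    note A = hs_adjoint_carrier[OF E X']
    have "mat_trace (hs_adjoint d d E (map_mat cnj X)) = mat_trace (map_mat cnj X)"
      unfolding hs_inner_one[OF A, symmetric] hs_inner_one[OF X', symmetric]
      using hs_adjoint_adjoint_inner[OF E one_carrier_mat X'] unital by simp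
    then show ?thesis using X A by (simp add: time_reversal_def trace_conj[of _ d])
  qed
  then show ?thesis
    unfolding cptp_def trace_preserving_def using linear_time_reversal[OF E]
      completely_positive_conj[OF completely_positive_hs_adjoint[OF cp E] hs_adjoint_linear[OF E]]
    by (simp add: time_reversal_def[abs_def])
qed

text \<open>A weak form of the fact that time reversal is an involution, suited to comparing
  supermaps through pairings.\<close>

lemma hs_inner_time_reversal:
  assumes E: "linear_map d d E" and X: "X \<in> carrier_mat d d" and Y: "Y \<in> carrier_mat d d"
  shows "hs_inner (time_reversal d E X) Y = hs_inner X (map_mat cnj (E (map_mat cnj Y)))"
proof -
  have X': "map_mat cnj X \<in> carrier_mat d d" and Y': "map_mat cnj Y \<in> carrier_mat d d"
    using X Y by auto
  have "hs_inner (time_reversal d E X) Y = cnj (hs_inner (hs_adjoint d d E (map_mat cnj X)) (map_mat cnj Y))"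
    using hs_inner_map_cnj[OF hs_adjoint_carrier[OF E X'] Y'] by (simp add: time_reversal_def)
  also have "\<dots> = cnj (hs_inner (map_mat cnj X) (E (map_mat cnj Y)))"
    by (simp add: hs_adjoint_inner[OF E X' Y'])
  also have "\<dots> = hs_inner X (map_mat cnj (E (map_mat cnj Y)))"
    using hs_inner_map_cnj[OF X' linear_map_carrier[OF E Y']] by simp
  finally show ?thesis .
qed

section \<open>Kets and bras on a tensor factor\<close>

text \<open>This is \<open>|u> \<otimes> 1\<close>, with the \<open>d\<close>-dimensional register
  as the fast index; \<open>bra_op\<close> is its adjoint \<open><u| \<otimes> 1\<close>.\<close>

definition ket_op :: "nat \<Rightarrow> nat \<Rightarrow> (nat \<Rightarrow> complex) \<Rightarrow> complex mat" where
  "ket_op n d u = mat (n * d) d (\<lambda>(i, s). if s = i mod d then u (i div d) else 0)"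

definition bra_op :: "nat \<Rightarrow> nat \<Rightarrow> (nat \<Rightarrow> complex) \<Rightarrow> complex mat" where
  "bra_op n d u = mat d (n * d) (\<lambda>(s, i). if i mod d = s then cnj (u (i div d)) else 0)"

lemma ket_op_carrier: "ket_op n d u \<in> carrier_mat (n * d) d"
  and bra_op_carrier: "bra_op n d u \<in> carrier_mat d (n * d)"
  by (simp_all add: ket_op_def bra_op_def)

lemma Ad_ket_op_index:
  assumes X: "X \<in> carrier_mat d d" and "a < n" "b < n" "s < d" "t < d"
  shows "Ad (ket_op n d u) X $$ (a * d + s, b * d + t) = u a * cnj (u b) * X $$ (s, t)"
proof -
  have "Ad (ket_op n d u) X $$ (a * d + s, b * d + t)
     = (\<Sum>i<d. \<Sum>j<d. if j = t then if i = s then u a * cnj (u b) * X $$ (i, j) else 0 else 0)"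
    unfolding Ad_index[OF ket_op_carrier X pair_index_less[OF assms(2,4)] pair_index_less[OF assms(3,5)]]
    using assms by (intro sum.cong refl) (auto simp: ket_op_def pair_index_less)
  then show ?thesis using assms by simp
qed

lemma Ad_bra_op_index:
  assumes X: "X \<in> carrier_mat (n * d) (n * d)" and s: "s < d" and t: "t < d"
  shows "Ad (bra_op n d u) X $$ (s, t) = (\<Sum>a<n. \<Sum>b<n. cnj (u a) * u b * X $$ (a * d + s, b * d + t))"
proof -
  have "Ad (bra_op n d u) X $$ (s, t)
     = (\<Sum>i<d. \<Sum>a<n. \<Sum>j<d. \<Sum>b<n.
         if j = t then if i = s then cnj (u a) * u b * X $$ (a * d + i, b * d + j) else 0 else 0)"
    unfolding Ad_index[OF bra_op_carrier X s t] sum_pair_index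
    using assms by (intro sum.cong refl) (auto simp: bra_op_def pair_index_less)
  also have "\<dots> = (\<Sum>i<d. \<Sum>j<d. \<Sum>a<n. \<Sum>b<n.
         if j = t then if i = s then cnj (u a) * u b * X $$ (a * d + i, b * d + j) else 0 else 0)"
    by (intro sum.cong refl sum.swap)
  also have "\<dots> = (\<Sum>i<d. \<Sum>j<d. if j = t then if i = s then
      (\<Sum>a<n. \<Sum>b<n. cnj (u a) * u b * X $$ (a * d + i, b * d + j)) else 0 else 0)"
    by (intro sum.cong refl) auto
  also have "\<dots> = (\<Sum>a<n. \<Sum>b<n. cnj (u a) * u b * X $$ (a * d + s, b * d + t))"
    using assms by simp
  finally show ?thesis .
qed

section \<open>The tester distinguishing \<open>G\<close> from its transpose\<close>

lemma sum_lessThan_4: "(\<Sum>a<4. g a) = g 0 + g 1 + g 2 + (g 3 :: complex)" for g :: "nat \<Rightarrow> complex"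
  by (simp add: numeral_eq_Suc)

text \<open>
  The probe is half of the maximally entangled state \<open>bell\<close> of \<open>A \<otimes> R\<close>, with \<open>R\<close> a second qubit;
  a basis vector \<open>e\<^sub>a \<otimes> e\<^sub>r\<close> has index \<open>q = 2 * a + r\<close>.  For \<open>z = exp (i\<pi> / 4)\<close> the vector
  \<open>flip_vec z\<close> is the normalized vectorization of \<open>G\<close>, and for \<open>cnj z\<close> that of its transpose.
  The remaining subspace, spanned by \<open>e\<^sub>0 \<otimes> e\<^sub>0\<close> and \<open>e\<^sub>1 \<otimes> e\<^sub>1\<close>, is invariant under the swap and
  is divided evenly between the two effects.
\<close>

definition bell :: "nat \<Rightarrow> complex" where
  "bell q = (if q = 0 \<or> q = 3 then 1 / of_real (sqrt 2) else 0)"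

definition basis_half :: "nat \<Rightarrow> nat \<Rightarrow> complex" where
  "basis_half p q = (if q = p then 1 / of_real (sqrt 2) else 0)"

definition flip_vec :: "complex \<Rightarrow> nat \<Rightarrow> complex" where
  "flip_vec z q = (if q = 1 then z / of_real (sqrt 2) else if q = 2 then cnj z / of_real (sqrt 2) else 0)"

text \<open>The unnormalized state left on the \<open>d\<close>-dimensional register, with one Kraus
  operator per summand. The factor one half on \<open>e\<^sub>0 \<otimes> e\<^sub>0\<close> and
  \<open>e\<^sub>1 \<otimes> e\<^sub>1\<close> comes from \<open>basis_half\<close>.\<close>

definition effect :: "nat \<Rightarrow> complex \<Rightarrow> complex mat \<Rightarrow> complex mat" where
  "effect d z X = Ad (bra_op 4 d (basis_half 0)) X + Ad (bra_op 4 d (basis_half 3)) X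
     + Ad (bra_op 4 d (flip_vec z)) X"

lemma linear_effect: "linear_map (4 * d) d (effect d z)"
  unfolding effect_def[abs_def] by (intro linear_map_sum linear_map_Ad bra_op_carrier)

lemma completely_positive_effect: "completely_positive (4 * d) d (effect d z)"
  unfolding effect_def[abs_def]
  by (intro completely_positive_sum completely_positive_Ad linear_map_sum linear_map_Ad bra_op_carrier)

lemma sqrt2_sqrt2: "complex_of_real (sqrt 2) * complex_of_real (sqrt 2) = 2"
  by (metis of_real_mult of_real_numeral real_sqrt_mult_self abs_numeral)

text \<open>The parameter enters only through the coherence between
  \<open>e\<^sub>0 \<otimes> e\<^sub>1\<close> and \<open>e\<^sub>1 \<otimes> e\<^sub>0\<close>, and
  there only as \<open>z\<^sup>2\<close>.\<close>

lemma effect_index: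
  assumes X: "X \<in> carrier_mat (4 * d) (4 * d)" and "s < d" "t < d" and z: "cnj z * z = 1"
  shows "effect d z X $$ (s, t) = (X $$ (s, t) + X $$ (d + s, d + t) + X $$ (2 * d + s, 2 * d + t)
      + X $$ (3 * d + s, 3 * d + t) + cnj (z\<^sup>2) * X $$ (d + s, 2 * d + t)
      + z\<^sup>2 * X $$ (2 * d + s, d + t)) / 2"
proof -
  have c: "Ad (bra_op 4 d u) X \<in> carrier_mat d d" for u
    using linear_map_carrier[OF linear_map_Ad[OF bra_op_carrier] X] .
  have z': "z * cnj z = 1" using z by (simp add: mult.commute)
  show ?thesis
    using assms(2,3) carrier_matD[OF c]
    by (simp add: effect_def Ad_bra_op_index[OF X] sum_lessThan_4 basis_half_def flip_vec_def
        sqrt2_sqrt2 z z' power2_eq_square add_divide_distrib)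
qed

text \<open>The squares of \<open>z\<close> and \<open>cnj z\<close> are opposite, so the coherences
  cancel in the sum and the diagonal halves add up to the full trace.\<close>

lemma trace_effects:
  assumes X: "X \<in> carrier_mat (4 * d) (4 * d)" and z: "cnj z * z = 1" "z\<^sup>2 = \<i>"
  shows "mat_trace (effect d z X) + mat_trace (effect d (cnj z) X) = mat_trace X"
proof -
  have z': "cnj (cnj z) * cnj z = 1" "(cnj z)\<^sup>2 = - \<i>"
    using z by (simp add: mult.commute) (metis z(2) complex_cnj_power complex_cnj_i)
  note c = linear_map_carrier[OF linear_effect X]
  have "mat_trace (effect d z X) + mat_trace (effect d (cnj z) X)
      = (\<Sum>s<d. effect d z X $$ (s, s) + effect d (cnj z) X $$ (s, s))"
    by (simp add: trace_carrier[OF c] sum.distrib)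
  also have "\<dots> = (\<Sum>s<d. \<Sum>a<4. X $$ (a * d + s, a * d + s))"
    by (intro sum.cong refl) (simp add: effect_index[OF X _ _ z(1)] effect_index[OF X _ _ z'(1)]
        z z' sum_lessThan_4 field_simps)
  also have "\<dots> = mat_trace X"
    using X by (simp add: trace_carrier sum_pair_index)
  finally show ?thesis .
qed

text \<open>
  The probability of the effect \<open>effect d z\<close> on the probe sent through \<open>N\<close>, with \<open>c = z\<^sup>2\<close>.
\<close>

definition outcome :: "complex \<Rightarrow> (complex mat \<Rightarrow> complex mat) \<Rightarrow> complex" where
  "outcome c N = (N (elem_mat 2 0 0) $$ (0, 0) + N (elem_mat 2 1 1) $$ (0, 0)
     + N (elem_mat 2 0 0) $$ (1, 1) + N (elem_mat 2 1 1) $$ (1, 1)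
     + cnj c * N (elem_mat 2 1 0) $$ (0, 1) + c * N (elem_mat 2 0 1) $$ (1, 0)) / 4"

text \<open>The right-hand side is an entry of half the Choi operator of \<open>N\<close>, times
  \<open>R\<close>. The index is that of \<open>A \<otimes> R \<otimes> B\<close>, with qubit digits
  \<open>a\<close> and \<open>p\<close> and register digit \<open>s\<close>; the memory is the last
  two factors.\<close>

lemma tensor_id_bell_index:
  assumes N: "linear_map 2 2 N" and R: "R \<in> carrier_mat d d"
    and "a < 2" "b < 2" "p < 2" "q < 2" and s: "s < d" and t: "t < d"
  shows "tensor_id 2 2 (2 * d) N (Ad (ket_op 4 d bell) R) $$ ((2 * a + p) * d + s, (2 * b + q) * d + t)
    = N (elem_mat 2 p q) $$ (a, b) * R $$ (s, t) / 2"
proof -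
  let ?B = "block 2 (2 * d) (Ad (ket_op 4 d bell) R) (p * d + s) (q * d + t)"
  have ps: "p * d + s < 2 * d" and qt: "q * d + t < 2 * d"
    using assms pair_index_less by auto
  have "?B = (R $$ (s, t) / 2) \<cdot>\<^sub>m elem_mat 2 p q"
  proof (rule eq_matI)
    fix x y assume "x < dim_row ((R $$ (s, t) / 2) \<cdot>\<^sub>m elem_mat 2 p q)"
      "y < dim_col ((R $$ (s, t) / 2) \<cdot>\<^sub>m elem_mat 2 p q)"
    then have xy: "x < 2" "y < 2" by (auto simp: elem_mat_def)
    have bell: "bell (2 * x + p) = (if x = p then 1 / of_real (sqrt 2) else 0)"
      if "x < 2" "p < 2" for x p
      using that by (auto simp: bell_def less_2_cases_iff)
    \<comment> \<open>Two groupings of the same index: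
      \<open>x * (2 * d) + (p * d + s) = (2 * x + p) * d + s\<close>.\<close>
    have "?B $$ (x, y) = Ad (ket_op 4 d bell) R $$ ((2 * x + p) * d + s, (2 * y + q) * d + t)"
      using xy by (simp add: block_def algebra_simps)
    also have "\<dots> = bell (2 * x + p) * cnj (bell (2 * y + q)) * R $$ (s, t)"
      using xy assms by (intro Ad_ket_op_index[OF R]) auto
    also have "\<dots> = ((R $$ (s, t) / 2) \<cdot>\<^sub>m elem_mat 2 p q) $$ (x, y)"
      using xy assms by (simp add: bell elem_mat_def sqrt2_sqrt2)
    finally show "?B $$ (x, y) = ((R $$ (s, t) / 2) \<cdot>\<^sub>m elem_mat 2 p q) $$ (x, y)" .
  qed (auto simp: elem_mat_def block_def)
  then have NB: "N ?B = (R $$ (s, t) / 2) \<cdot>\<^sub>m N (elem_mat 2 p q)"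
    by (simp add: linear_map_smult[OF N])
  have "tensor_id 2 2 (2 * d) N (Ad (ket_op 4 d bell) R) $$ ((2 * a + p) * d + s, (2 * b + q) * d + t)
      = block 2 (2 * d) (tensor_id 2 2 (2 * d) N (Ad (ket_op 4 d bell) R)) (p * d + s) (q * d + t) $$ (a, b)"
    using assms by (simp add: block_def algebra_simps)
  also have "\<dots> = N (elem_mat 2 p q) $$ (a, b) * R $$ (s, t) / 2"
    unfolding block_tensor_id[OF N ps qt] NB
    using assms carrier_matD[OF linear_map_carrier[OF N elem_mat_carrier]] by simp
  finally show ?thesis .
qed

text \<open>The probe is uncorrelated with the register, so conditioning on an effect only rescales
  the register's state.\<close>

lemma effect_tensor_id_bell:
  assumes N: "linear_map 2 2 N" and R: "R \<in> carrier_mat d d" and z: "cnj z * z = 1"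
  shows "effect d z (tensor_id 2 2 (2 * d) N (Ad (ket_op 4 d bell) R)) = outcome (z\<^sup>2) N \<cdot>\<^sub>m R"
proof -
  let ?T = "tensor_id 2 2 (2 * d) N (Ad (ket_op 4 d bell) R)"
  have T: "?T \<in> carrier_mat (4 * d) (4 * d)"
    using tensor_id_carrier[of 2 2 "2 * d" N] by simp
  show ?thesis
  proof (rule eq_matI)
    fix s t assume "s < dim_row (outcome (z\<^sup>2) N \<cdot>\<^sub>m R)" "t < dim_col (outcome (z\<^sup>2) N \<cdot>\<^sub>m R)"
    then have st: "s < d" "t < d" using R by auto
    note i = tensor_id_bell_index[OF N R _ _ _ _ st]
    have T_st: "?T $$ (s, t) = N (elem_mat 2 0 0) $$ (0, 0) * R $$ (s, t) / 2"
      "?T $$ (d + s, d + t) = N (elem_mat 2 1 1) $$ (0, 0) * R $$ (s, t) / 2"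
      "?T $$ (2 * d + s, 2 * d + t) = N (elem_mat 2 0 0) $$ (1, 1) * R $$ (s, t) / 2"
      "?T $$ (3 * d + s, 3 * d + t) = N (elem_mat 2 1 1) $$ (1, 1) * R $$ (s, t) / 2"
      "?T $$ (d + s, 2 * d + t) = N (elem_mat 2 1 0) $$ (0, 1) * R $$ (s, t) / 2"
      "?T $$ (2 * d + s, d + t) = N (elem_mat 2 0 1) $$ (1, 0) * R $$ (s, t) / 2"
      using i[of 0 0 0 0] i[of 0 0 1 1] i[of 1 1 0 0] i[of 1 1 1 1] i[of 0 1 1 0] i[of 1 0 0 1]
      by simp_all
    show "effect d z ?T $$ (s, t) = (outcome (z\<^sup>2) N \<cdot>\<^sub>m R) $$ (s, t)"
      unfolding effect_index[OF T st z] T_st using st R by (simp add: outcome_def field_simps)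
  qed (use R linear_map_carrier[OF linear_effect T] in auto)
qed

lemma cptp_ket_bell: "cptp d (4 * d) (Ad (ket_op 4 d bell))"
proof -
  have "mat_trace (Ad (ket_op 4 d bell) R) = mat_trace R" if R: "R \<in> carrier_mat d d" for R
  proof -
    have "mat_trace (Ad (ket_op 4 d bell) R) = (\<Sum>s<d. \<Sum>a<4. bell a * cnj (bell a) * R $$ (s, s))"
      unfolding trace_carrier[OF linear_map_carrier[OF linear_map_Ad[OF ket_op_carrier] R]] sum_pair_index
      by (intro sum.cong refl Ad_ket_op_index[OF R]) auto
    also have "\<dots> = mat_trace R"
      using R by (simp add: sum_lessThan_4 bell_def sqrt2_sqrt2 trace_carrier)
    finally show ?thesis .
  qed
  then show ?thesis
    by (auto simp: cptp_def trace_preserving_def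
        intro!: linear_map_Ad completely_positive_Ad ket_op_carrier)
qed

text \<open>Adjoint and conjugation together exchange input and output indices. The four population
  terms are permuted among themselves, while the two coherence terms trade places and hence
  coefficients.\<close>

lemma outcome_hs_adjoint:
  assumes N: "linear_map 2 2 N"
  shows "outcome c (hs_adjoint 2 2 (\<lambda>X. map_mat cnj (N (map_mat cnj X)))) = outcome (cnj c) N"
proof -
  let ?N = "\<lambda>X. map_mat cnj (N (map_mat cnj X))"
  note N' = linear_map_conj[OF N]
  have "hs_adjoint 2 2 ?N (elem_mat 2 i j) $$ (a, b) = N (elem_mat 2 a b) $$ (i, j)"
    if "i < 2" "j < 2" "a < 2" "b < 2" for i j a b
  proof -
    have e: "map_mat cnj (elem_mat 2 a b) = elem_mat 2 a b"
      by (intro eq_matI) (auto simp: elem_mat_def)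
    note c = linear_map_carrier[OF N elem_mat_carrier]
    have "cnj (hs_adjoint 2 2 ?N (elem_mat 2 i j) $$ (a, b)) =
        hs_inner (hs_adjoint 2 2 ?N (elem_mat 2 i j)) (elem_mat 2 a b)"
      using that hs_adjoint_carrier[OF N' elem_mat_carrier] by (simp add: hs_inner_elem)
    also have "\<dots> = hs_inner (elem_mat 2 i j) (map_mat cnj (N (elem_mat 2 a b)))"
      by (simp add: hs_adjoint_inner[OF N'] e)
    also have "\<dots> = cnj (hs_inner (map_mat cnj (N (elem_mat 2 a b))) (elem_mat 2 i j))"
      using c by (intro hs_inner_conj) auto
    also have "\<dots> = cnj (N (elem_mat 2 a b) $$ (i, j))"
      using that c carrier_matD[OF c] by (simp add: hs_inner_elem)
    finally show ?thesis by simp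
  qed
  then show ?thesis by (simp add: outcome_def algebra_simps)
qed

section \<open>The two outcomes on \<open>Ad G_mat\<close>\<close>

definition phase :: complex where
  "phase = exp (of_real pi * \<i> / 4)"

lemma phase_eq: "phase = cis (pi / 4)"
  by (simp add: phase_def cis_conv_exp mult_ac)

lemma cnj_phase: "cnj phase * phase = 1" "phase * cnj phase = 1"
  by (simp_all add: phase_eq cis_cnj cis_mult)

lemma phase_square: "phase\<^sup>2 = \<i>" "phase * phase = \<i>"
  by (simp_all add: phase_eq power2_eq_square cis_mult)

lemma G_mat_index:
  "G_mat $$ (0, 0) = 0" "G_mat $$ (0, 1) = phase" "G_mat $$ (1, 0) = cnj phase" "G_mat $$ (1, 1) = 0"
  and G_mat_carrier: "G_mat \<in> carrier_mat 2 2"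
proof -
  have "exp (- (of_real pi * \<i> / 4)) = cnj phase"
    unfolding phase_eq cis_cnj by (simp add: cis_conv_exp mult_ac)
  then show "G_mat $$ (0, 0) = 0" "G_mat $$ (0, 1) = phase" "G_mat $$ (1, 0) = cnj phase" "G_mat $$ (1, 1) = 0"
    by (auto simp: G_mat_def phase_def[symmetric] mat_of_rows_list_def)
  show "G_mat \<in> carrier_mat 2 2" by (simp add: G_mat_def mat_of_rows_list_def numeral_2_eq_2)
qed

text \<open>The populations sum to \<open>2\<close>. The coherences
  \<open>phase\<^sup>2 = \<i>\<close> and its conjugate, weighted by \<open>cnj c\<close> and
  \<open>c\<close>, contribute \<open>+2\<close> for \<open>c = \<i>\<close> and \<open>-2\<close>
  for \<open>c = - \<i>\<close>.\<close>

lemma outcome_Ad_G: "outcome \<i> (Ad G_mat) = 1" "outcome (- \<i>) (Ad G_mat) = 0"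
proof -
  have "Ad G_mat (elem_mat 2 i j) $$ (a, b) = G_mat $$ (a, i) * cnj (G_mat $$ (b, j))"
    if "i < 2" "j < 2" "a < 2" "b < 2" for i j a b
  proof -
    have "Ad G_mat (elem_mat 2 i j) $$ (a, b) = (\<Sum>x<2. \<Sum>y<2.
       if y = j then if x = i then G_mat $$ (a, x) * cnj (G_mat $$ (b, y)) else 0 else 0)"
      unfolding Ad_index[OF G_mat_carrier elem_mat_carrier that(3,4)]
      by (intro sum.cong refl) (auto simp: elem_mat_def)
    then show ?thesis using that by simp
  qed
  moreover have "cnj phase * cnj phase = - \<i>"
    by (metis phase_square(2) complex_cnj_mult complex_cnj_i)
  ultimately show "outcome \<i> (Ad G_mat) = 1" "outcome (- \<i>) (Ad G_mat) = 0"
    by (simp_all add: outcome_def G_mat_index[unfolded One_nat_def] cnj_phase phase_square)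
qed

section \<open>The T-symmetric superchannel\<close>

text \<open>Written with outcome weights instead of a realization, so that exchanging the weights
  and exchanging the channels can be compared directly.\<close>

definition test_and_reverse :: "nat \<Rightarrow> (complex mat \<Rightarrow> complex mat) \<Rightarrow> supermap" where
  "test_and_reverse d E N R =
     outcome \<i> N \<cdot>\<^sub>m E R + outcome (- \<i>) N \<cdot>\<^sub>m time_reversal d E R"

definition decoder :: "nat \<Rightarrow> (complex mat \<Rightarrow> complex mat) \<Rightarrow> complex mat \<Rightarrow> complex mat" where
  "decoder d E X = E (effect d phase X) + time_reversal d E (effect d (cnj phase) X)"

text \<open>Measure, then apply the channel chosen by the outcome. Both channels preserve the trace
  and the two effects together exhaust it.\<close>

lemma cptp_decoder:
  assumes E: "cptp d d E" "E (1\<^sub>m d) = 1\<^sub>m d"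
  shows "cptp (4 * d) d (decoder d E)"
proof -
  have E': "linear_map d d E" "completely_positive d d E" "trace_preserving d E"
    using E by (auto simp: cptp_def)
  have R: "linear_map d d (time_reversal d E)" "completely_positive d d (time_reversal d E)"
    "trace_preserving d (time_reversal d E)"
    using cptp_time_reversal[OF E] by (auto simp: cptp_def)
  have "mat_trace (decoder d E X) = mat_trace X" if X: "X \<in> carrier_mat (4 * d) (4 * d)" for X
  proof -
    note c = linear_map_carrier[OF linear_effect X]
    have "mat_trace (decoder d E X) = mat_trace (effect d phase X) + mat_trace (effect d (cnj phase) X)"
      using E'(3) R(3) c unfolding decoder_def
        trace_add[OF linear_map_carrier[OF E'(1) c] linear_map_carrier[OF R(1) c]]
      by (simp add: trace_preserving_def)
    then show ?thesis using trace_effects[OF X cnj_phase(1) phase_square(1)] by simp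
  qed
  then show ?thesis
    unfolding cptp_def trace_preserving_def decoder_def[abs_def]
    by (intro conjI ballI linear_map_sum completely_positive_sum linear_map_comp[OF linear_effect]
        completely_positive_comp[OF completely_positive_effect] E' R linear_effect) simp
qed

text \<open>The memory of dimension \<open>2 * d\<close> holds the reference qubit and the input
  register. The squares of \<open>phase\<close> and \<open>cnj phase\<close> are \<open>\<i>\<close>
  and \<open>- \<i>\<close>, the parameters of the two outcomes.\<close>

lemma realizes_test_and_reverse:
  assumes d: "d \<ge> 1" and E: "cptp d d E" "E (1\<^sub>m d) = 1\<^sub>m d"
  shows "realizes (conj_system 2) (conj_system d) (2 * d) (Ad (ket_op 4 d bell)) (decoder d E)
           (test_and_reverse d E)"
proof -
  have E': "linear_map d d E" using E by (auto simp: cptp_def)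
  have "test_and_reverse d E N R
      = decoder d E (tensor_id 2 2 (2 * d) N (Ad (ket_op 4 d bell) R))"
    if N: "linear_map 2 2 N" and R: "R \<in> carrier_mat d d" for N R
    using cnj_phase effect_tensor_id_bell[OF N R] phase_square(1)
      complex_cnj_power[of phase 2, symmetric]
    by (simp add: decoder_def test_and_reverse_def linear_map_smult[OF E' R]
        linear_map_smult[OF linear_time_reversal[OF E'] R])
  then show ?thesis
    using d cptp_ket_bell[of d] cptp_decoder[OF E] by (simp add: realizes_def conj_system_def)
qed

text \<open>
  Time reversal exchanges the two outcomes of the tester, because \<open>G\<^sup>T\<close> is the conjugate of
  \<open>G\<close>, and it exchanges \<open>E\<close> with its time reversal.
\<close>

lemma superchannel_adjoint_test_and_reverse:
  assumes d: "d \<ge> 1" and E: "cptp d d E" "E (1\<^sub>m d) = 1\<^sub>m d"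
    and N: "linear_map 2 2 N" and Y: "Y \<in> carrier_mat d d"
  shows "superchannel_adjoint (conj_system 2) (conj_system d) (test_and_reverse d E)
      (\<lambda>X. map_mat cnj (N (map_mat cnj X))) Y
    = map_mat cnj (test_and_reverse d E N (map_mat cnj Y))"
proof -
  let ?N = "\<lambda>X. map_mat cnj (N (map_mat cnj X))"
  let ?Z = "superchannel_adjoint (conj_system 2) (conj_system d) (test_and_reverse d E) ?N Y"
  note r = realizes_test_and_reverse[OF d E]
  have E': "linear_map d d E" using E by (auto simp: cptp_def)
  note R = linear_time_reversal[OF E'] and N' = linear_map_conj[OF N]
  have h: "hdim (conj_system m) = m" for m by (simp add: conj_system_def)
  note adj = superchannel_adjoint_eq[OF r, unfolded h, OF N' Y]
  have Y': "map_mat cnj Y \<in> carrier_mat d d" using Y by simp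
  have Zc: "?Z \<in> carrier_mat d d"
    unfolding adj using realized_adjoint_inner(1)[OF r, unfolded h, OF N' Y Y] .
  show ?thesis
  proof (rule hs_inner_eqI[OF Zc])
    show c: "map_mat cnj (test_and_reverse d E N (map_mat cnj Y)) \<in> carrier_mat d d"
      using linear_map_carrier[OF R Y'] by (simp add: test_and_reverse_def)
    fix X :: "complex mat" assume X: "X \<in> carrier_mat d d"
    note EX = linear_map_carrier[OF E' X] and RX = linear_map_carrier[OF R X]
    note EY = linear_map_carrier[OF E' Y'] and RY = linear_map_carrier[OF R Y']
    \<comment> \<open>Pairing with \<open>X\<close> trades the adjoint supermap for the supermap
      itself at the adjoint argument, where the closed form applies.\<close>
    have "hs_inner X ?Z = hs_inner (test_and_reverse d E (hs_adjoint 2 2 ?N) X) Y"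
      unfolding adj using realized_adjoint_inner(2)[OF r, unfolded h, OF N' X Y] .
    \<comment> \<open>The weights of \<open>\<i>\<close> and \<open>- \<i>\<close> change places by
      \<open>outcome_hs_adjoint\<close>; they are conjugated because \<open>hs_inner\<close> is
      antilinear in its first argument.\<close>
    also have "\<dots> = cnj (outcome (- \<i>) N) * hs_inner (E X) Y
        + cnj (outcome \<i> N) * hs_inner (time_reversal d E X) Y"
      using EX RX Y by (simp add: test_and_reverse_def outcome_hs_adjoint[OF N] hs_inner_sum[of _ d]
          sum_distrib_left sum.distrib ring_distribs mult_ac)
    also have "hs_inner (E X) Y = hs_inner X (map_mat cnj (time_reversal d E (map_mat cnj Y)))"
      using hs_adjoint_adjoint_inner[OF E' X Y] by (simp add: time_reversal_def)
    also note hs_inner_time_reversal[OF E' X Y]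
    also have "cnj (outcome (- \<i>) N) * hs_inner X (map_mat cnj (time_reversal d E (map_mat cnj Y)))
        + cnj (outcome \<i> N) * hs_inner X (map_mat cnj (E (map_mat cnj Y)))
        = hs_inner X (map_mat cnj (test_and_reverse d E N (map_mat cnj Y)))"
      using X EY RY by (simp add: test_and_reverse_def map_cnj_add[of _ d d] map_cnj_smult
          hs_inner_add_right[of _ d] hs_inner_smult_right[of _ d])
    finally show "hs_inner ?Z X = hs_inner (map_mat cnj (test_and_reverse d E N (map_mat cnj Y))) X"
      using X Zc c by (metis hs_inner_conj)
  qed
qed

theorem theorem8:
  fixes d :: nat and E :: "complex mat \<Rightarrow> complex mat"
  assumes "d \<ge> 1"
    and "unital_channel (conj_system d) E"
  shows "\<exists>f. T_symmetric (conj_system 2) (conj_system d) f \<and>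
             (\<forall>\<rho>\<in>carrier_mat d d. f (Ad G_mat) \<rho> = E \<rho>)"
proof (intro exI conjI ballI)
  let ?f = "test_and_reverse d E"
  let ?A = "conj_system 2" and ?B = "conj_system d"
  have h: "hdim (conj_system m) = m" "motion_rev (conj_system m) = conjugate" for m
    by (simp_all add: conj_system_def)
  have E: "cptp d d E" "E (1\<^sub>m d) = 1\<^sub>m d"
    using assms(2) by (auto simp: unital_channel_def h)
  then have lin: "linear_map d d E" by (simp add: cptp_def)
  note r = realizes_test_and_reverse[OF assms(1) E]
  \<comment> \<open>The weights are \<open>1\<close> and \<open>0\<close>; the carrier facts supply
    the dimensions needed to drop the vanishing summand.\<close>
  show "?f (Ad G_mat) \<rho> = E \<rho>" if "\<rho> \<in> carrier_mat d d" for \<rho>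
    using linear_map_carrier[OF lin that] linear_map_carrier[OF linear_time_reversal[OF lin] that]
    by (intro eq_matI) (auto simp: test_and_reverse_def outcome_Ad_G)
  show "T_symmetric ?A ?B ?f"
    unfolding T_symmetric_def h
  proof (intro conjI allI impI ballI)
    show "deterministic_superchannel ?A ?B ?f"
      using r valid_conj_system assms(1) unfolding deterministic_superchannel_def by auto
    fix N :: "complex mat \<Rightarrow> complex mat" and \<rho> :: "complex mat"
    assume N: "linear_map 2 2 N" and \<rho>: "\<rho> \<in> carrier_mat d d"
    have \<rho>': "map_mat cnj \<rho> \<in> carrier_mat d d" using \<rho> by simp
    \<comment> \<open>Conjugation is its own antiunitary adjoint, so both motion-reversal maps are
      entrywise conjugation.\<close>
    have Ad1: "Ad_anti n conjugate X = map_mat cnj X"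
      and Ad2: "Ad_anti n (anti_adjoint n conjugate) X = map_mat cnj X"
      if "X \<in> carrier_mat n n" for n X
      using that by (auto intro!: Ad_anti_conjugate anti_adjoint_conjugate)
    define N' where "N' = Ad_anti 2 conjugate \<circ> N \<circ> Ad_anti 2 (anti_adjoint 2 conjugate)"
    have N'_eq: "N' X = map_mat cnj (N (map_mat cnj X))" if "X \<in> carrier_mat 2 2" for X
      using that linear_map_carrier[OF N, of "map_mat cnj X"] by (simp add: N'_def Ad1 Ad2)
    have lin_N': "linear_map 2 2 N'"
      using linear_map_conj[OF N] by (simp add: linear_map_def N'_eq)
    \<comment> \<open>\<open>N'\<close> is known to agree with the conjugated map only on the
      carrier. A realized adjoint sees its argument only through \<open>tensor_id\<close>, which
      evaluates it on blocks, and these lie in the carrier.\<close>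
    have "tensor_id 2 2 k N' = tensor_id 2 2 k (\<lambda>X. map_mat cnj (N (map_mat cnj X)))" for k
      by (intro ext) (simp add: tensor_id_def N'_eq)
    then have "superchannel_adjoint ?A ?B ?f N' (map_mat cnj \<rho>)
        = superchannel_adjoint ?A ?B ?f (\<lambda>X. map_mat cnj (N (map_mat cnj X))) (map_mat cnj \<rho>)"
      using superchannel_adjoint_eq[OF r, unfolded h] lin_N' linear_map_conj[OF N] \<rho>'
      by (simp add: realized_adjoint_def h)
    also have "\<dots> = map_mat cnj (?f N \<rho>)"
      using superchannel_adjoint_test_and_reverse[OF assms(1) E N \<rho>'] by simp
    finally have "reverse_simulator ?A ?B ?f N \<rho>
        = Ad_anti d (anti_adjoint d conjugate) (map_mat cnj (?f N \<rho>))"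
      using \<rho> by (simp add: reverse_simulator_def h N'_def Ad1)
    also have "\<dots> = ?f N \<rho>"
      using linear_map_carrier[OF linear_time_reversal[OF lin] \<rho>]
      by (subst Ad2) (auto simp: test_and_reverse_def)
    finally show "?f N \<rho> = reverse_simulator ?A ?B ?f N \<rho>" by simp
  qed
qed

end
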